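(* Let $\theta>1/2$. There is a constant $C$ (not depending on $n$) such that for all $n\ge2$, $$\max_{1\le i<j\le n}\ \sup_{\bm\beta\in[0,2n^{-1/2}]^n}\mathrm{Cov}_{n,\theta,\bm\beta}(k_i,k_j\,|\,U)\le C.$$
   Context: $Y$ is a symmetric $n\times n$ matrix with $Y_{ij}\in\{-1,1\}$ for $i\ne j$ and $Y_{ii}=0$; $k_i=\sum_{j=1}^nY_{ij}$. The degree corrected two-star ERGM is $$\mathbb{P}_{n,\theta,\bm\beta}(Y)=\frac1{Z_n(\bm\beta,\theta)}\exp\Big\{\frac{\theta}{n-1}\Big(\frac12\sum_{i=1}^nk_i^2-\frac{n(n-1)}2\Big)+\frac12\sum_{i=1}^n\beta_ik_i\Big\},$$ with $Z_n$ the normalizing constant. For $\theta>1/2$, $t$ denotes the unique positive root of $x=\tanh(2\theta x)$. $U=\bigcap_{i=1}^n\{k_i\ge(n-1)t/2\}$, and $\mathrm{Cov}_{n,\theta,\bm\beta}(\cdot,\cdot|U)$ is the covariance under $\mathbb{P}_{n,\theta,\bm\beta}$ conditioned on the event $U$. *)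

theory Defs
  imports "HOL-Probability.Probability"
begin

text \<open>Symmetric \<open>n \<times> n\<close> matrices with zero diagonal and off-diagonal entries in \<open>{-1, 1}\<close>.
  Since \<open>n\<close> varies, a matrix is a function on \<open>nat \<times> nat\<close> with indices \<open>1, \<dots>, n\<close>,
  set to \<open>0\<close> outside this range so that distinct functions are distinct matrices.\<close>

definition configs :: "nat \<Rightarrow> (nat \<Rightarrow> nat \<Rightarrow> real) set" where
  "configs n = {Y. (\<forall>i j. Y i j = Y j i) \<and>
     (\<forall>i\<in>{1..n}. \<forall>j\<in>{1..n}. i \<noteq> j \<longrightarrow> Y i j \<in> {-1, 1}) \<and>
     (\<forall>i\<in>{1..n}. Y i i = 0) \<and>
     (\<forall>i j. i \<notin> {1..n} \<or> j \<notin> {1..n} \<longrightarrow> Y i j = 0)}"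

definition deg :: "nat \<Rightarrow> nat \<Rightarrow> (nat \<Rightarrow> nat \<Rightarrow> real) \<Rightarrow> real" where
  "deg n i Y = (\<Sum>j=1..n. Y i j)"

definition weight :: "nat \<Rightarrow> real \<Rightarrow> (nat \<Rightarrow> real) \<Rightarrow> (nat \<Rightarrow> nat \<Rightarrow> real) \<Rightarrow> real" where
  "weight n \<theta> \<beta> Y =
     exp (\<theta> / (real n - 1) * (1/2 * (\<Sum>i=1..n. (deg n i Y)\<^sup>2) - real n * (real n - 1) / 2)
        + 1/2 * (\<Sum>i=1..n. \<beta> i * deg n i Y))"

definition Zn :: "nat \<Rightarrow> real \<Rightarrow> (nat \<Rightarrow> real) \<Rightarrow> real" where
  "Zn n \<theta> \<beta> = (\<Sum>Y\<in>configs n. weight n \<theta> \<beta> Y)"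

definition ergm :: "nat \<Rightarrow> real \<Rightarrow> (nat \<Rightarrow> real) \<Rightarrow> (nat \<Rightarrow> nat \<Rightarrow> real) pmf" where
  "ergm n \<theta> \<beta> = embed_pmf (\<lambda>Y. if Y \<in> configs n then weight n \<theta> \<beta> Y / Zn n \<theta> \<beta> else 0)"

definition pos_root :: "real \<Rightarrow> real" where
  "pos_root \<theta> = (THE x. x > 0 \<and> x = tanh (2 * \<theta> * x))"

definition U_event :: "nat \<Rightarrow> real \<Rightarrow> (nat \<Rightarrow> nat \<Rightarrow> real) set" where
  "U_event n \<theta> = (\<Inter>i\<in>{1..n}. {Y. deg n i Y \<ge> (real n - 1) * pos_root \<theta> / 2})"

definition covariance :: "'a measure \<Rightarrow> ('a \<Rightarrow> real) \<Rightarrow> ('a \<Rightarrow> real) \<Rightarrow> real" where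
  "covariance M X Y =
     (\<integral>\<omega>. (X \<omega> - (\<integral>\<omega>'. X \<omega>' \<partial>M)) * (Y \<omega> - (\<integral>\<omega>'. Y \<omega>' \<partial>M)) \<partial>M)"

definition cov_deg_U :: "nat \<Rightarrow> real \<Rightarrow> (nat \<Rightarrow> real) \<Rightarrow> nat \<Rightarrow> nat \<Rightarrow> real" where
  "cov_deg_U n \<theta> \<beta> i j =
     covariance (measure_pmf (cond_pmf (ergm n \<theta> \<beta>) (U_event n \<theta>))) (deg n i) (deg n j)"


text \<open>The remaining facts show that \<open>embed_pmf\<close>, \<open>THE\<close> and \<open>cond_pmf\<close> are applied
  above within their domains of definition.\<close>

lemma finite_configs: "finite (configs n)"
proof -
  let ?F = "{f :: nat \<times> nat \<Rightarrow> real. \<forall>p. (p \<in> {1..n} \<times> {1..n} \<longrightarrow> f p \<in> {-1, 0, 1}) \<and>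
      (p \<notin> {1..n} \<times> {1..n} \<longrightarrow> f p = 0)}"
  have "finite ?F"
    by (rule finite_set_of_finite_funs) auto
  moreover have "configs n \<subseteq> curry ` ?F"
  proof
    fix Y assume Y: "Y \<in> configs n"
    have "case_prod Y \<in> ?F"
    proof (rule CollectI, rule allI)
      fix p :: "nat \<times> nat"
      obtain i j where p: "p = (i, j)" by fastforce
      show "(p \<in> {1..n} \<times> {1..n} \<longrightarrow> case_prod Y p \<in> {-1, 0, 1}) \<and>
          (p \<notin> {1..n} \<times> {1..n} \<longrightarrow> case_prod Y p = 0)"
      proof (cases "i \<in> {1..n} \<and> j \<in> {1..n}")
        case True
        then have "Y i j \<in> {-1, 0, 1}"
          using Y unfolding configs_def by (cases "i = j") blast+
        then show ?thesis using True by (simp add: p)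
      next
        case False
        then have "Y i j = 0" using Y unfolding configs_def by blast
        then show ?thesis by (simp add: p)
      qed
    qed
    moreover have "Y = curry (case_prod Y)" by simp
    ultimately show "Y \<in> curry ` ?F" by blast
  qed
  ultimately show ?thesis by (meson finite_imageI finite_subset)
qed

definition ones :: "nat \<Rightarrow> nat \<Rightarrow> nat \<Rightarrow> real" where
  "ones n i j = (if i \<in> {1..n} \<and> j \<in> {1..n} \<and> i \<noteq> j then 1 else 0)"

lemma ones_in_configs: "ones n \<in> configs n"
  by (auto simp: configs_def ones_def)

lemma weight_pos: "weight n \<theta> \<beta> Y > 0"
  by (simp add: weight_def)

lemma Zn_pos: "Zn n \<theta> \<beta> > 0"
  unfolding Zn_def using ones_in_configs
  by (intro sum_pos finite_configs) (auto simp: weight_pos)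

lemma pmf_ergm:
  "pmf (ergm n \<theta> \<beta>) Y = (if Y \<in> configs n then weight n \<theta> \<beta> Y / Zn n \<theta> \<beta> else 0)"
  unfolding ergm_def
proof (rule pmf_embed_pmf)
  let ?f = "\<lambda>Y. if Y \<in> configs n then weight n \<theta> \<beta> Y / Zn n \<theta> \<beta> else 0"
  show nn: "0 \<le> ?f Y" for Y
    by (simp add: weight_pos Zn_pos less_imp_le)
  have "(\<integral>\<^sup>+Y. ennreal (?f Y) \<partial>count_space UNIV) = (\<Sum>Y\<in>configs n. ennreal (?f Y))"
    by (rule nn_integral_count_space') (auto simp: finite_configs)
  also have "\<dots> = ennreal (\<Sum>Y\<in>configs n. ?f Y)"
    using nn by (intro sum_ennreal)
  also have "(\<Sum>Y\<in>configs n. ?f Y) = 1"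
    using Zn_pos[of n \<theta> \<beta>] by (simp add: sum_divide_distrib[symmetric] Zn_def)
  finally show "(\<integral>\<^sup>+Y. ennreal (?f Y) \<partial>count_space UNIV) = 1" by simp
qed

lemma set_pmf_ergm: "set_pmf (ergm n \<theta> \<beta>) = configs n"
  using Zn_pos[of n \<theta> \<beta>] weight_pos[of n \<theta> \<beta>]
  by (auto simp: set_pmf_eq pmf_ergm less_imp_neq[symmetric])

lemma ex1_pos_root:
  assumes "\<theta> > 1/2"
  shows "\<exists>!x::real. x > 0 \<and> x = tanh (2 * \<theta> * x)"
proof -
  define f where "f x = tanh (2 * \<theta> * x) - x" for x :: real
  have df: "(f has_real_derivative (1 - (tanh (2 * \<theta> * x))\<^sup>2) * (2 * \<theta>) - 1) (at x)" for x
    unfolding f_def by (auto intro!: derivative_eq_intros)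
  have cont: "continuous_on S f" for S
    using df by (intro DERIV_continuous_on) (auto intro: has_field_derivative_at_within)
  have "(f has_real_derivative 2 * \<theta> - 1) (at 0)"
    using df[of 0] by simp
  moreover have "2 * \<theta> - 1 > 0" using assms by simp
  ultimately obtain d where d: "d > 0" "\<forall>h>0. h < d \<longrightarrow> f 0 < f (0 + h)"
    using DERIV_pos_inc_right by blast
  define a where "a = min (d/2) (1/2)"
  have a: "0 < a" "a < 1" "f a > 0"
    using d(1) d(2)[rule_format, of a] by (auto simp: a_def f_def)
  have "f 1 \<le> 0"
    using tanh_real_lt_1[of "2 * \<theta>"] by (simp add: f_def)
  then obtain r where r: "a \<le> r" "f r = 0"
    using IVT2'[of f 1 0 a] a cont by auto
  have no: False if xy: "0 < x" "x < y" and z: "f x = 0" "f y = 0" for x y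
  proof -
    have "f 0 = 0" by (simp add: f_def)
    have diff: "f differentiable (at u)" for u
      using df real_differentiable_def by blast
    obtain b where b: "0 < b" "b < x" "(f has_real_derivative 0) (at b)"
      using Rolle[of 0 x f] xy z \<open>f 0 = 0\<close> cont diff by auto
    obtain c where c: "x < c" "c < y" "(f has_real_derivative 0) (at c)"
      using Rolle[of x y f] xy z cont diff by auto
    have "(1 - (tanh (2 * \<theta> * b))\<^sup>2) * (2 * \<theta>) = (1 - (tanh (2 * \<theta> * c))\<^sup>2) * (2 * \<theta>)"
      using DERIV_unique[OF df b(3)] DERIV_unique[OF df c(3)] by simp
    hence "(tanh (2 * \<theta> * b))\<^sup>2 = (tanh (2 * \<theta> * c))\<^sup>2"
      using assms by simp
    moreover have "tanh (2 * \<theta> * b) > 0" "tanh (2 * \<theta> * c) > 0"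
      using assms b c xy by auto
    ultimately have "tanh (2 * \<theta> * b) = tanh (2 * \<theta> * c)"
      by (simp add: power2_eq_iff_nonneg)
    thus False using assms b c by simp
  qed
  show ?thesis
  proof (rule ex1I[of _ r])
    show "r > 0 \<and> r = tanh (2 * \<theta> * r)" using r a by (simp add: f_def)
    fix x assume x: "x > 0 \<and> x = tanh (2 * \<theta> * x)"
    show "x = r"
      using no[of x r] no[of r x] x r a by (force simp: f_def)
  qed
qed

lemma pos_root:
  assumes "\<theta> > 1/2"
  shows "pos_root \<theta> > 0" and "pos_root \<theta> = tanh (2 * \<theta> * pos_root \<theta>)" and "pos_root \<theta> < 1"
proof -
  have *: "pos_root \<theta> > 0 \<and> pos_root \<theta> = tanh (2 * \<theta> * pos_root \<theta>)"
    unfolding pos_root_def by (rule theI'[OF ex1_pos_root[OF assms]])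
  then show "pos_root \<theta> > 0" "pos_root \<theta> = tanh (2 * \<theta> * pos_root \<theta>)" by auto
  then show "pos_root \<theta> < 1" using tanh_real_lt_1 by metis
qed

lemma deg_ones: "i \<in> {1..n} \<Longrightarrow> deg n i (ones n) = real n - 1"
proof -
  assume i: "i \<in> {1..n}"
  have "deg n i (ones n) = (\<Sum>j\<in>{1..n} - {i}. 1)"
    unfolding deg_def using i by (intro sum.mono_neutral_cong_right) (auto simp: ones_def)
  also have "\<dots> = real n - 1"
    using i by (simp add: of_nat_diff)
  finally show ?thesis .
qed

lemma U_event_possible:
  assumes "\<theta> > 1/2"
  shows "set_pmf (ergm n \<theta> \<beta>) \<inter> U_event n \<theta> \<noteq> {}"
proof -
  have "(real n - 1) * pos_root \<theta> / 2 \<le> real n - 1" if "n \<ge> 1"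
    using mult_left_mono[of "pos_root \<theta>" 1 "real n - 1"] pos_root(3)[OF assms] that by simp
  hence "ones n \<in> U_event n \<theta>"
    by (auto simp: U_event_def deg_ones)
  thus ?thesis using ones_in_configs set_pmf_ergm by blast
qed

end

theory Submission
  imports Defs "HOL-Real_Asymp.Real_Asymp"
begin

text \<open>
  A matrix is encoded by its set of edges with value \<open>1\<close>; the model is then a ferromagnetic Gibbs
  measure with weight \<open>exp (\<Sum>i. \<phi>\<^sub>i (k\<^sub>i))\<close>. Flipping one entry of row \<open>i\<close> from \<open>-1\<close> to \<open>1\<close> keeps
  \<open>U\<close> invariant and, as long as all relative degrees \<open>k\<^sub>j / (n - 1)\<close> are at least \<open>r\<close>, multiplies the
  weight by at least \<open>exp (4 \<theta> r)\<close>. Counting entries, relative degrees below \<open>tanh (2 \<theta> r)\<close> are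
  exponentially unlikely. Since \<open>tanh (2 \<theta> r) > r\<close> on \<open>(0, t)\<close>, finitely many rounds starting from
  \<open>r = t / 2\<close> show that under the conditioned measure all relative degrees exceed a fixed \<open>s < t\<close>,
  up to exponentially small probability, where \<open>s\<close> is chosen with
  \<open>2 \<theta> (1 - tanh\<^sup>2 (2 \<theta> s)) < 1\<close>.

  On that event the weight is unchanged if \<open>k\<^sup>2\<close> is replaced by its tangent below \<open>(n - 1) s\<close>.
  The unconditioned measure so obtained has the same exponential tail and satisfies Dobrushin's
  uniqueness condition with the above constant, for every field \<open>\<beta> \<ge> 0\<close>. Dobrushin's covariance
  bound with edge weights \<open>2 + O(1/n)\<close> at vertex \<open>j\<close> and \<open>O(1/n)\<close> elsewhere gives
  \<open>Cov(k\<^sub>i, k\<^sub>j) = O(1)\<close>, and passing back to the conditioned measure costs \<open>n\<^sup>2\<close> times an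
  exponentially small quantity.
\<close>

section \<open>Dobrushin's covariance bound for Gibbs measures on subsets\<close>

lemma sum_Pow_split:
  fixes F :: "'a set \<Rightarrow> real"
  assumes "finite E" "e \<in> E"
  shows "(\<Sum>S\<in>Pow E. F S) = (\<Sum>S\<in>Pow (E - {e}). F S + F (insert e S))"
proof -
  have "Pow E = Pow (E - {e}) \<union> insert e ` Pow (E - {e})"
    using Pow_insert[of e "E - {e}"] assms(2) by (simp add: insert_absorb)
  moreover have "Pow (E - {e}) \<inter> insert e ` Pow (E - {e}) = {}" by auto
  moreover have "inj_on (insert e) (Pow (E - {e}))"
    by (auto simp: inj_on_def)
  ultimately show ?thesis
    using assms(1) by (simp add: sum.union_disjoint sum.reindex sum.distrib)
qed

text \<open>Single-site oscillations. Comparing \<open>insert e S\<close> with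
  \<open>S - {e}\<close> makes the bound independent of whether \<open>e\<close> lies in
  \<open>S\<close>.\<close>

definition osc_le :: "'a set \<Rightarrow> ('a set \<Rightarrow> real) \<Rightarrow> ('a \<Rightarrow> real) \<Rightarrow> bool" where
  "osc_le E h v \<longleftrightarrow> (\<forall>e\<in>E. \<forall>S\<subseteq>E. \<bar>h (insert e S) - h (S - {e})\<bar> \<le> v e)"

lemma osc_leD: "osc_le E h v \<Longrightarrow> e \<in> E \<Longrightarrow> S \<subseteq> E \<Longrightarrow> \<bar>h (insert e S) - h (S - {e})\<bar> \<le> v e"
  by (auto simp: osc_le_def)

lemma osc_leD':
  assumes "osc_le E h v" "e \<in> E" "S \<subseteq> E" "e \<notin> S"
  shows "\<bar>h (insert e S) - h S\<bar> \<le> v e"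
  using osc_leD[OF assms(1-3)] assms(4) by simp

text \<open>Build \<open>S\<close> from \<open>{}\<close> one site at a time. This a priori bound
  starts the iteration in \<open>dobrushin_covariance\<close>.\<close>

lemma osc_le_dist_empty:
  assumes "finite E" "osc_le E h v" "S \<subseteq> E"
  shows "\<bar>h S - h {}\<bar> \<le> sum v E"
proof -
  have v: "v e \<ge> 0" if "e \<in> E" for e
    using osc_leD[OF assms(2) that, of "{}"] by simp
  have "finite S" using assms finite_subset by blast
  from this assms(3) have "\<bar>h S - h {}\<bar> \<le> sum v S"
  proof (induction S)
    case (insert e S)
    then have "\<bar>h (insert e S) - h S\<bar> \<le> v e"
      using osc_leD'[OF assms(2)] by simp
    moreover have "\<bar>h S - h {}\<bar> \<le> sum v S" using insert by simp
    ultimately show ?case using insert.hyps by simp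
  qed simp
  also have "\<dots> \<le> sum v E"
    using assms v by (intro sum_mono2) auto
  finally show ?thesis .
qed

section \<open>Heat-bath dynamics of a positive weight on subsets\<close>

locale gibbs =
  fixes E :: "'a set" and w :: "'a set \<Rightarrow> real"
  assumes finite_E: "finite E" and w_pos: "S \<subseteq> E \<Longrightarrow> w S > 0"
begin

text \<open>Conditional probability that \<open>e\<close> is present given all other sites.
  Accordingly \<open>heat e h\<close> is the conditional expectation of \<open>h\<close> given those
  sites, and \<open>glauber\<close> resamples a uniformly chosen site.\<close>

definition up :: "'a \<Rightarrow> 'a set \<Rightarrow> real" where
  "up e S = w (insert e S) / (w (insert e S) + w (S - {e}))"

definition heat :: "'a \<Rightarrow> ('a set \<Rightarrow> real) \<Rightarrow> 'a set \<Rightarrow> real" where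
  "heat e h S = up e S * h (insert e S) + (1 - up e S) * h (S - {e})"

definition glauber :: "('a set \<Rightarrow> real) \<Rightarrow> 'a set \<Rightarrow> real" where
  "glauber h S = (\<Sum>e\<in>E. heat e h S) / card E"

lemma up_bounds:
  assumes "e \<in> E" "S \<subseteq> E" shows "0 \<le> up e S" "up e S \<le> 1"
proof -
  have "w (insert e S) > 0" "w (S - {e}) > 0" using assms by (auto intro!: w_pos)
  then show "0 \<le> up e S" "up e S \<le> 1" by (auto simp: up_def)
qed

text \<open>The configurations pair up as \<open>S\<close> and \<open>insert e S\<close>, of weights
  x and y. Each pair contributes xy / (x + y) times the increments of \<open>f\<close> and
  \<open>h\<close>, and xy / (x + y) is at most (x + y) / 4.\<close>

lemma dirichlet_bound:
  assumes e: "e \<in> E" and f: "osc_le E f a" and h: "osc_le E h b"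
  shows "\<bar>\<Sum>S\<in>Pow E. w S * f S * (h S - heat e h S)\<bar> \<le> a e * b e / 4 * sum w (Pow E)"
proof -
  have "\<bar>\<Sum>S\<in>Pow E. w S * f S * (h S - heat e h S)\<bar>
      = \<bar>\<Sum>S\<in>Pow (E - {e}). w S * f S * (h S - heat e h S) +
          w (insert e S) * f (insert e S) * (h (insert e S) - heat e h (insert e S))\<bar>"
    by (subst sum_Pow_split[OF finite_E e]) simp
  also have "\<dots> \<le> (\<Sum>S\<in>Pow (E - {e}). a e * b e / 4 * (w S + w (insert e S)))"
  proof (rule order_trans[OF sum_abs sum_mono])
    fix S assume "S \<in> Pow (E - {e})"
    then have S: "S \<subseteq> E" "e \<notin> S" by auto
    define x y where "x = w S" and "y = w (insert e S)"
    have xy: "x > 0" "y > 0" using S e by (auto simp: x_def y_def intro!: w_pos)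
    define p c where "p = y / (x + y)" and "c = x * y / (x + y)"
    \<comment> \<open>Detailed balance: the flow between the two configurations is the same in both
      directions.\<close>
    have p: "x * p = c" "y * (1 - p) = c"
      using xy by (auto simp: p_def c_def field_simps)
    have heat: "heat e h S = p * h (insert e S) + (1 - p) * h S" "heat e h (insert e S) = heat e h S"
      using S by (auto simp: heat_def up_def p_def x_def y_def add.commute)
    have "w S * f S * (h S - heat e h S) +
          w (insert e S) * f (insert e S) * (h (insert e S) - heat e h (insert e S))
        = (y * (1 - p)) * f (insert e S) * (h (insert e S) - h S)
          - (x * p) * f S * (h (insert e S) - h S)"
      unfolding heat x_def[symmetric] y_def[symmetric] by (simp add: algebra_simps)
    also have "\<dots> = x * y / (x + y) * ((f (insert e S) - f S) * (h (insert e S) - h S))"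
      unfolding p by (simp add: c_def[symmetric] algebra_simps)
    also have "\<bar>\<dots>\<bar> = x * y / (x + y) * (\<bar>f (insert e S) - f S\<bar> * \<bar>h (insert e S) - h S\<bar>)"
      using xy by (simp add: abs_mult)
    also have "\<dots> \<le> ((x + y) / 4) * (a e * b e)"
    proof (rule mult_mono)
      have "4 * (x * y) \<le> (x + y) * (x + y)"
        using sum_squares_ge_zero[of "x - y" 0] by (simp add: algebra_simps)
      then show "x * y / (x + y) \<le> (x + y) / 4"
        using xy by (simp add: field_simps)
      show "\<bar>f (insert e S) - f S\<bar> * \<bar>h (insert e S) - h S\<bar> \<le> a e * b e"
        using osc_leD'[OF f e S] osc_leD'[OF h e S] by (intro mult_mono) auto
    qed (use xy in auto)
    finally show "\<bar>w S * f S * (h S - heat e h S) +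
          w (insert e S) * f (insert e S) * (h (insert e S) - heat e h (insert e S))\<bar>
        \<le> a e * b e / 4 * (w S + w (insert e S))"
      by (simp add: x_def y_def mult_ac)
  qed
  also have "\<dots> = a e * b e / 4 * sum w (Pow E)"
    by (simp add: sum_Pow_split[OF finite_E e, of w] sum_distrib_left)
  finally show ?thesis .
qed

text \<open>Resampling \<open>e\<close> forgets the state of \<open>e\<close>, whence the 0. For
  \<open>g\<close> different from \<open>e\<close>, changing \<open>g\<close> alters
  \<open>h\<close> directly by at most \<open>v g\<close>, averaged over both states of
  \<open>e\<close>, and alters the resampling probability by at most \<open>C e g\<close>, which
  costs \<open>v e\<close> per unit.\<close>

lemma heat_osc:
  assumes e: "e \<in> E" and g: "g \<in> E" and S: "S \<subseteq> E" and h: "osc_le E h v"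
    and C: "e \<noteq> g \<Longrightarrow> \<bar>up e (insert g S) - up e (S - {g})\<bar> \<le> C e g"
  shows "\<bar>heat e h (insert g S) - heat e h (S - {g})\<bar> \<le> (if e = g then 0 else v g + C e g * v e)"
proof (cases "e = g")
  case True
  then show ?thesis by (simp add: heat_def up_def)
next
  case False
  define A where "A = S - {g} - {e}"
  have A: "A \<subseteq> E" "e \<notin> A" "g \<notin> A" using S by (auto simp: A_def)
  have up_e: "up e (insert e T) = up e T" "up e (T - {e}) = up e T" for T
    by (auto simp: up_def)
  define p q where "p = up e (insert g S)" and "q = up e (S - {g})"
  have pq: "0 \<le> p" "p \<le> 1" "\<bar>p - q\<bar> \<le> C e g"
    using up_bounds[OF e, of "insert g S"] S g C False by (auto simp: p_def q_def)
  have sets: "insert e (insert g S) = insert g (insert e A)" "insert g S - {e} = insert g A"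
     "insert e (S - {g}) = insert e A" "S - {g} - {e} = A"
    using False by (auto simp: A_def)
  have "heat e h (insert g S) - heat e h (S - {g}) =
      p * (h (insert g (insert e A)) - h (insert e A)) + (1 - p) * (h (insert g A) - h A)
      + (p - q) * (h (insert e A) - h A)"
    unfolding heat_def p_def[symmetric] q_def[symmetric] sets by (simp add: algebra_simps)
  also have "\<bar>\<dots>\<bar> \<le> p * v g + (1 - p) * v g + C e g * v e"
  proof -
    have "\<bar>p * (h (insert g (insert e A)) - h (insert e A))\<bar> \<le> p * v g"
      using osc_leD'[OF h g, of "insert e A"] A e False pq by (simp add: abs_mult mult_left_mono)
    moreover have "\<bar>(1 - p) * (h (insert g A) - h A)\<bar> \<le> (1 - p) * v g"
      using osc_leD'[OF h g, of A] A pq by (simp add: abs_mult mult_left_mono)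
    moreover have "\<bar>(p - q) * (h (insert e A) - h A)\<bar> \<le> C e g * v e"
      unfolding abs_mult using osc_leD'[OF h e, of A] A pq by (intro mult_mono) auto
    ultimately show ?thesis by linarith
  qed
  finally show ?thesis using False by (simp add: algebra_simps)
qed

text \<open>Averaging \<open>heat_osc\<close> over \<open>e\<close>: resampling \<open>g\<close>
  itself contributes nothing, the other \<open>N - 1\<close> sites contribute \<open>v g\<close>
  each, and the influences add at most \<open>\<kappa> * v g\<close>.\<close>

lemma glauber_osc:
  assumes h: "osc_le E h v" and ne: "E \<noteq> {}"
    and C: "\<And>e g S. e \<in> E \<Longrightarrow> g \<in> E \<Longrightarrow> e \<noteq> g \<Longrightarrow> S \<subseteq> E \<Longrightarrow>
       \<bar>up e (insert g S) - up e (S - {g})\<bar> \<le> C e g"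
    and k: "\<And>g. g \<in> E \<Longrightarrow> (\<Sum>e\<in>E - {g}. C e g * v e) \<le> \<kappa> * v g"
  shows "osc_le E (glauber h) (\<lambda>e. (1 - (1 - \<kappa>) / card E) * v e)"
  unfolding osc_le_def
proof (intro ballI allI impI)
  fix g S assume g: "g \<in> E" and S: "S \<subseteq> E"
  define N where "N = real (card E)"
  have N: "N > 0" using ne finite_E by (simp add: N_def card_gt_0_iff)
  have "\<bar>glauber h (insert g S) - glauber h (S - {g})\<bar>
      = \<bar>\<Sum>e\<in>E. heat e h (insert g S) - heat e h (S - {g})\<bar> / N"
    using N by (simp add: glauber_def N_def[symmetric] sum_subtractf diff_divide_distrib[symmetric])
  also have "\<dots> \<le> (\<Sum>e\<in>E. if e = g then 0 else v g + C e g * v e) / N"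
    using N by (intro divide_right_mono order_trans[OF sum_abs sum_mono] heat_osc[OF _ g S h] C g S) auto
  also have "(\<Sum>e\<in>E. if e = g then 0 else v g + C e g * v e) = (\<Sum>e\<in>E - {g}. v g + C e g * v e)"
    using finite_E g by (subst sum.remove[of _ g]) (auto intro!: sum.cong)
  also have "\<dots> = (N - 1) * v g + (\<Sum>e\<in>E - {g}. C e g * v e)"
    using finite_E g N by (simp add: sum.distrib N_def of_nat_diff card_gt_0_iff Suc_leI)
  also have "\<dots> / N \<le> ((N - 1) * v g + \<kappa> * v g) / N"
    using k[OF g] N by (intro divide_right_mono) auto
  also have "\<dots> = (1 - (1 - \<kappa>) / N) * v g" using N by (simp add: field_simps)
  finally show "\<bar>glauber h (insert g S) - glauber h (S - {g})\<bar> \<le> (1 - (1 - \<kappa>) / card E) * v g"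
    by (simp add: N_def)
qed

text \<open>With \<open>B h\<close> the pairing of \<open>f\<close> and \<open>h\<close>, the Dirichlet form controls \<open>B h - B (glauber h)\<close>,
  while \<open>glauber h\<close> again satisfies the oscillation bound, shrunk by a factor \<open>r < 1\<close>;
  iterating gives a geometric series.\<close>

lemma dobrushin_covariance:
  assumes f: "osc_le E f a" and h: "osc_le E h v" and ne: "E \<noteq> {}"
    and f0: "(\<Sum>S\<in>Pow E. w S * f S) = 0"
    and C: "\<And>e g S. e \<in> E \<Longrightarrow> g \<in> E \<Longrightarrow> e \<noteq> g \<Longrightarrow> S \<subseteq> E \<Longrightarrow>
       \<bar>up e (insert g S) - up e (S - {g})\<bar> \<le> C e g"
    and k: "\<And>g. g \<in> E \<Longrightarrow> (\<Sum>e\<in>E - {g}. C e g * v e) \<le> \<kappa> * v g"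
    and \<kappa>: "0 < \<kappa>" "\<kappa> < 1"
  shows "\<bar>\<Sum>S\<in>Pow E. w S * f S * h S\<bar> \<le> (\<Sum>e\<in>E. a e * v e) / (4 * (1 - \<kappa>)) * sum w (Pow E)"
proof -
  define N where "N = real (card E)"
  have N: "N \<ge> 1" using ne finite_E by (simp add: N_def card_gt_0_iff Suc_leI)
  define r where "r = 1 - (1 - \<kappa>) / N"
  \<comment> \<open>\<open>\<kappa> > 0\<close> keeps \<open>r\<close> strictly positive, as the
    later rescaling divides by \<open>r\<close>.\<close>
  have "(1 - \<kappa>) / N \<le> (1 - \<kappa>) / 1" using N \<kappa> by (intro divide_left_mono) auto
  then have r: "0 < r" "r < 1" using N \<kappa> by (auto simp: r_def)
  define Z where "Z = sum w (Pow E)"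
  define A where "A = (\<Sum>e\<in>E. a e * v e) / (4 * N) * Z"
  define K where "K = (\<Sum>S\<in>Pow E. w S * \<bar>f S\<bar>) * sum v E"
  define B where "B h = (\<Sum>S\<in>Pow E. w S * f S * h S)" for h :: "'a set \<Rightarrow> real"
  have K: "\<bar>B h\<bar> \<le> K" if h: "osc_le E h v" for h
  proof -
    \<comment> \<open>As \<open>f\<close> is centred, \<open>h\<close> may be shifted by a constant,
      so its oscillation replaces its size.\<close>
    have "B h = (\<Sum>S\<in>Pow E. w S * f S * (h S - h {}))"
      using f0 by (simp add: B_def right_diff_distrib sum_subtractf sum_distrib_right[symmetric])
    also have "\<bar>\<dots>\<bar> \<le> (\<Sum>S\<in>Pow E. w S * \<bar>f S\<bar> * sum v E)"
    proof (rule order_trans[OF sum_abs sum_mono])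
      fix S assume "S \<in> Pow E"
      then show "\<bar>w S * f S * (h S - h {})\<bar> \<le> w S * \<bar>f S\<bar> * sum v E"
        using osc_le_dist_empty[OF finite_E h, of S] w_pos[of S]
        by (auto simp: abs_mult intro!: mult_left_mono)
    qed
    finally show ?thesis by (simp add: K_def sum_distrib_right)
  qed
  have step: "\<bar>B h - B (glauber h)\<bar> \<le> A" if h: "osc_le E h v" for h
  proof -
    have g: "glauber h S = (\<Sum>e\<in>E. heat e h S) / N" for S by (simp add: glauber_def N_def)
    have "B h - B (glauber h) = (\<Sum>S\<in>Pow E. w S * f S * (h S - glauber h S))"
      by (simp add: B_def right_diff_distrib sum_subtractf)
    also have "\<dots> = (\<Sum>S\<in>Pow E. (\<Sum>e\<in>E. w S * f S * (h S - heat e h S)) / N)"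
    proof (rule sum.cong)
      fix S
      have "h S - glauber h S = (\<Sum>e\<in>E. h S - heat e h S) / N"
        using N by (simp add: g sum_subtractf N_def[symmetric] diff_divide_distrib)
      then show "w S * f S * (h S - glauber h S) = (\<Sum>e\<in>E. w S * f S * (h S - heat e h S)) / N"
        by (simp add: sum_distrib_left)
    qed simp
    also have "\<dots> = (\<Sum>e\<in>E. \<Sum>S\<in>Pow E. w S * f S * (h S - heat e h S)) / N"
      by (subst sum.swap) (simp add: sum_divide_distrib[symmetric])
    also have "\<bar>\<dots>\<bar> \<le> (\<Sum>e\<in>E. a e * v e / 4 * Z) / N"
    proof -
      have "\<bar>\<Sum>e\<in>E. \<Sum>S\<in>Pow E. w S * f S * (h S - heat e h S)\<bar> \<le> (\<Sum>e\<in>E. a e * v e / 4 * Z)"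
        unfolding Z_def by (intro order_trans[OF sum_abs sum_mono] dirichlet_bound f h)
      then show ?thesis using N by (simp add: divide_right_mono)
    qed
    also have "\<dots> = A" by (simp add: A_def sum_distrib_right sum_divide_distrib)
    finally show ?thesis .
  qed
  have iter: "osc_le E h v \<Longrightarrow> \<bar>B h\<bar> \<le> A / (1 - r) + r ^ m * K" for h m
  proof (induction m arbitrary: h)
    case 0
    have "A \<ge> 0" using step[OF 0] by linarith
    then have "A / (1 - r) \<ge> 0" using r by simp
    then show ?case using K[OF 0] by simp
  next
    case (Suc m)
    \<comment> \<open>Division by \<open>r\<close> restores the original bound \<open>v\<close>, so
      the induction hypothesis applies to \<open>?g\<close>.\<close>
    let ?g = "\<lambda>S. glauber h S / r"
    have "osc_le E (glauber h) (\<lambda>e. r * v e)"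
      unfolding r_def N_def by (rule glauber_osc[OF Suc.prems ne C k])
    then have "osc_le E ?g v"
      using r by (auto simp: osc_le_def diff_divide_distrib[symmetric] pos_divide_le_eq mult.commute)
    from Suc.IH[OF this] have "\<bar>B ?g\<bar> \<le> A / (1 - r) + r ^ m * K" .
    moreover have "B (glauber h) = r * B ?g"
      using r by (simp add: B_def sum_distrib_left)
    ultimately have "\<bar>B (glauber h)\<bar> \<le> r * (A / (1 - r) + r ^ m * K)"
      using r by (simp add: abs_mult)
    then have "\<bar>B h\<bar> \<le> A + r * (A / (1 - r) + r ^ m * K)"
      using step[OF Suc.prems] by linarith
    also have "\<dots> = A / (1 - r) + r ^ Suc m * K"
      using r by (simp add: field_simps)
    finally show ?case .
  qed
  have "(\<lambda>m. A / (1 - r) + r ^ m * K) \<longlonglongrightarrow> A / (1 - r) + 0 * K"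
    using r by (intro tendsto_intros LIMSEQ_power_zero) auto
  then have "\<bar>B h\<bar> \<le> A / (1 - r)"
    using iter[OF h] by (intro LIMSEQ_le_const) auto
  \<comment> \<open>\<open>1 - r\<close> is \<open>(1 - \<kappa>) / N\<close>, which cancels the
    \<open>1 / N\<close> from choosing a random site.\<close>
  also have "A / (1 - r) = (\<Sum>e\<in>E. a e * v e) / (4 * (1 - \<kappa>)) * Z"
    using N \<kappa> by (simp add: A_def r_def)
  finally show ?thesis by (simp add: B_def Z_def)
qed

text \<open>Double counting of the pairs (configuration, absent site of \<open>D\<close>) against the pairs
  (configuration, present site of \<open>D\<close>).\<close>

lemma lift_step:
  assumes V: "\<V> \<subseteq> Pow E" and D: "D \<subseteq> E"
    and up_closed: "\<And>S e. S \<in> \<V> \<Longrightarrow> e \<in> D - S \<Longrightarrow> insert e S \<in> \<V>"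
    and R: "\<And>S e. S \<in> \<V> \<Longrightarrow> e \<in> D - S \<Longrightarrow> R * w S \<le> w (insert e S)" "R \<ge> 0"
    and a: "a \<le> card D"
  shows "R * (real (card D) - real a) * (\<Sum>S | S \<in> \<V> \<and> card (D \<inter> S) < a. w S)
    \<le> real a * (\<Sum>S | S \<in> \<V> \<and> card (D \<inter> S) < Suc a. w S)"
proof -
  have finD: "finite D" using D finite_E finite_subset by blast
  have finV: "finite \<V>" using V finite_E by (meson finite_Pow_iff finite_subset)
  define A where "A = {S. S \<in> \<V> \<and> card (D \<inter> S) < a}"
  define B where "B = {S. S \<in> \<V> \<and> card (D \<inter> S) < Suc a}"
  have fin: "finite A" "finite B" using finV by (auto simp: A_def B_def)
  have wp: "S \<in> \<V> \<Longrightarrow> w S > 0" for S using V w_pos by blast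
  have "R * (real (card D) - real a) * sum w A = (\<Sum>S\<in>A. (real (card D) - real a) * (R * w S))"
    unfolding sum_distrib_left by (rule sum.cong) (simp_all add: mult_ac)
  also have "\<dots> \<le> (\<Sum>S\<in>A. \<Sum>e\<in>D - S. w (insert e S))"
  proof (rule sum_mono)
    fix S assume S: "S \<in> A"
    then have SV: "S \<in> \<V>" and c: "card (D \<inter> S) < a" by (auto simp: A_def)
    have "card (D - S) + card (D \<inter> S) = card D"
      using card_Int_Diff[OF finD, of S] by simp
    then have "real (card D) - real a \<le> real (card (D - S))" using c by linarith
    then have "(real (card D) - real a) * (R * w S) \<le> real (card (D - S)) * (R * w S)"
      using R(2) wp[OF SV] by (intro mult_right_mono) auto
    also have "\<dots> = (\<Sum>e\<in>D - S. R * w S)" by simp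
    also have "\<dots> \<le> (\<Sum>e\<in>D - S. w (insert e S))"
      by (intro sum_mono R(1) SV)
    finally show "(real (card D) - real a) * (R * w S) \<le> (\<Sum>e\<in>D - S. w (insert e S))" .
  qed
  also have "\<dots> = (\<Sum>(S, e)\<in>Sigma A (\<lambda>S. D - S). w (insert e S))"
    using fin finD by (subst sum.Sigma) auto
  \<comment> \<open>Recording \<open>e\<close> next to \<open>insert e S\<close> makes the map
    injective, since \<open>e\<close> is not in \<open>S\<close>.\<close>
  also have "\<dots> = (\<Sum>(T, e)\<in>(\<lambda>(S, e). (insert e S, e)) ` Sigma A (\<lambda>S. D - S). w T)"
  proof (subst sum.reindex)
    show "inj_on (\<lambda>(S, e). (insert e S, e)) (Sigma A (\<lambda>S. D - S))"
      by (rule inj_onI) (auto simp: insert_ident)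
  qed (auto intro!: sum.cong)
  also have "\<dots> \<le> (\<Sum>(T, e)\<in>Sigma B (\<lambda>T. D \<inter> T). w T)"
  proof (rule sum_mono2)
    show "finite (Sigma B (\<lambda>T. D \<inter> T))" using fin finD by auto
    show "(\<lambda>(S, e). (insert e S, e)) ` Sigma A (\<lambda>S. D - S) \<subseteq> Sigma B (\<lambda>T. D \<inter> T)"
      using up_closed finD by (auto simp: A_def B_def)
  qed (use wp in \<open>auto simp: B_def less_imp_le\<close>)
  also have "\<dots> = (\<Sum>T\<in>B. real (card (D \<inter> T)) * w T)"
    using fin finD by (subst sum.Sigma[symmetric]) auto
  also have "\<dots> \<le> (\<Sum>T\<in>B. real a * w T)"
    using wp by (intro sum_mono mult_right_mono) (auto simp: B_def less_imp_le)
  finally show ?thesis by (simp add: A_def B_def sum_distrib_left)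
qed

text \<open>Each \<open>lift_step\<close> raises the level by one and gains the factor
  \<open>\<rho>\<close>, which bounds \<open>b / (R * (card D - b))\<close> at each of the
  \<open>m\<close> levels passed.\<close>

lemma lift_iterate:
  assumes V: "\<V> \<subseteq> Pow E" and D: "D \<subseteq> E"
    and up_closed: "\<And>S e. S \<in> \<V> \<Longrightarrow> e \<in> D - S \<Longrightarrow> insert e S \<in> \<V>"
    and R: "\<And>S e. S \<in> \<V> \<Longrightarrow> e \<in> D - S \<Longrightarrow> R * w S \<le> w (insert e S)" "R > 0"
    and \<rho>: "\<And>b. a \<le> b \<Longrightarrow> b < a + m \<Longrightarrow> real b \<le> \<rho> * (R * (real (card D) - real b))"
    and am: "a + m \<le> card D" and \<rho>0: "\<rho> \<ge> 0"
  shows "(\<Sum>S | S \<in> \<V> \<and> card (D \<inter> S) < a. w S) \<le> \<rho> ^ m * sum w \<V>"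
  using \<rho> am
proof (induction m arbitrary: a)
  case 0
  have finV: "finite \<V>" using V finite_E by (meson finite_Pow_iff finite_subset)
  show ?case
    using V w_pos finV by (auto intro!: sum_mono2 simp: less_imp_le subset_iff)
next
  case (Suc m)
  define F where "F a = (\<Sum>S | S \<in> \<V> \<and> card (D \<inter> S) < a. w S)" for a
  have F0: "F a \<ge> 0" for a
    using V w_pos by (auto simp: F_def less_imp_le subset_iff intro!: sum_nonneg)
  define c where "c = R * (real (card D) - real a)"
  have c: "c > 0" using Suc.prems(2) R(2) by (simp add: c_def)
  have "c * F a \<le> real a * F (Suc a)"
    unfolding c_def F_def using Suc.prems(2) R
    by (intro lift_step V D up_closed) auto
  also have "\<dots> \<le> \<rho> * c * F (Suc a)"
    using Suc.prems(1)[of a] F0 by (intro mult_right_mono) (auto simp: c_def)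
  finally have "F a \<le> \<rho> * F (Suc a)" using c by (simp add: mult_ac)
  also have "F (Suc a) \<le> \<rho> ^ m * sum w \<V>"
    unfolding F_def using Suc.prems by (intro Suc.IH) auto
  finally show ?case using \<rho>0 by (simp add: F_def mult_left_mono)
qed

end

section \<open>Covariance under weights that agree on a large set\<close>

definition wmean :: "'a set \<Rightarrow> ('a \<Rightarrow> real) \<Rightarrow> ('a \<Rightarrow> real) \<Rightarrow> real" where
  "wmean A w f = (\<Sum>x\<in>A. w x * f x) / sum w A"

definition wcov :: "'a set \<Rightarrow> ('a \<Rightarrow> real) \<Rightarrow> ('a \<Rightarrow> real) \<Rightarrow> ('a \<Rightarrow> real) \<Rightarrow> real" where
  "wcov A w f g = wmean A w (\<lambda>x. (f x - wmean A w f) * (g x - wmean A w g))"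

text \<open>Covariance through two independent copies, unnormalised. No mean occurs in it, so
  shrinking \<open>A\<close> merely drops terms.\<close>

definition pair_sum :: "'a set \<Rightarrow> ('a \<Rightarrow> real) \<Rightarrow> ('a \<Rightarrow> real) \<Rightarrow> ('a \<Rightarrow> real) \<Rightarrow> real" where
  "pair_sum A w f g = (\<Sum>(x, y)\<in>A \<times> A. w x * w y * ((f x - f y) * (g x - g y)))"

text \<open>Centring one factor suffices. This is the form that \<open>dobrushin_covariance\<close>
  bounds.\<close>

lemma wcov_right_centred:
  assumes "sum w A \<noteq> 0"
  shows "wcov A w f g = (\<Sum>x\<in>A. w x * (f x - wmean A w f) * g x) / sum w A"
proof -
  have "wmean A w f * sum w A = (\<Sum>x\<in>A. w x * f x)"
    using assms by (simp add: wmean_def)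
  then have "(\<Sum>x\<in>A. w x * (f x - wmean A w f)) = 0"
    by (simp add: right_diff_distrib sum_subtractf sum_distrib_right[symmetric] mult.commute)
  then have "(\<Sum>x\<in>A. w x * (f x - wmean A w f) * wmean A w g) = 0"
    by (simp add: sum_distrib_right[symmetric])
  moreover have "wcov A w f g = ((\<Sum>x\<in>A. w x * (f x - wmean A w f) * g x)
      - (\<Sum>x\<in>A. w x * (f x - wmean A w f) * wmean A w g)) / sum w A"
    unfolding wcov_def wmean_def[of _ _ "\<lambda>x. _ x * _ x"] sum_subtractf[symmetric]
    by (simp add: algebra_simps wmean_def[of _ _ "\<lambda>x. (_ x - _) * _ x"])
  ultimately show ?thesis by simp
qed

lemma pair_sum_eq:
  assumes "sum w A \<noteq> 0"
  shows "pair_sum A w f g = 2 * (sum w A)\<^sup>2 * wcov A w f g"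
proof -
  define W Sf Sg Sfg where "W = sum w A" and "Sf = (\<Sum>x\<in>A. w x * f x)"
    and "Sg = (\<Sum>x\<in>A. w x * g x)" and "Sfg = (\<Sum>x\<in>A. w x * (f x * g x))"
  have W: "W \<noteq> 0" using assms by (simp add: W_def)
  have "pair_sum A w f g = (\<Sum>x\<in>A. \<Sum>y\<in>A. w x * (f x * g x) * w y + w x * (w y * (f y * g y))
      - w x * f x * (w y * g y) - w x * g x * (w y * f y))"
    unfolding pair_sum_def sum.cartesian_product[symmetric]
    by (intro sum.cong) (auto simp: algebra_simps)
  also have "\<dots> = Sfg * W + W * Sfg - Sf * Sg - Sg * Sf"
    unfolding W_def Sf_def Sg_def Sfg_def sum_product by (simp add: sum.distrib sum_subtractf)
  finally have 1: "pair_sum A w f g = 2 * (W * Sfg - Sf * Sg)" by (simp add: algebra_simps)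
  have "wcov A w f g = (\<Sum>x\<in>A. w x * (f x * g x) - Sf / W * (w x * g x)) / W"
    unfolding wcov_right_centred[OF assms] W_def Sf_def wmean_def
    by (simp add: algebra_simps)
  also have "\<dots> = (Sfg - Sf / W * Sg) / W"
    by (simp add: sum_subtractf sum_distrib_left Sfg_def Sg_def)
  finally show ?thesis
    unfolding 1 W_def[symmetric] using W by (simp add: field_simps power2_eq_square)
qed

text \<open>The dropped pairs have a coordinate outside \<open>V\<close>, hence lie in two strips,
  and each term is at most \<open>4 * d\<^sup>2\<close> times its weight.\<close>

lemma pair_sum_diff:
  assumes A: "finite A" "V \<subseteq> A" and w: "\<And>x. x \<in> A \<Longrightarrow> w x \<ge> 0"
    and f: "\<And>x. x \<in> A \<Longrightarrow> \<bar>f x\<bar> \<le> d" and g: "\<And>x. x \<in> A \<Longrightarrow> \<bar>g x\<bar> \<le> d"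
  shows "\<bar>pair_sum A w f g - pair_sum V w f g\<bar> \<le> 8 * d\<^sup>2 * sum w A * sum w (A - V)"
proof -
  let ?F = "\<lambda>(x, y). w x * w y * ((f x - f y) * (g x - g y))"
  let ?G = "\<lambda>(x, y). w x * w y * (4 * d\<^sup>2)"
  have V: "finite V" using A finite_subset by blast
  have "pair_sum A w f g - pair_sum V w f g = sum ?F (A \<times> A - V \<times> V)"
    using A unfolding pair_sum_def by (subst sum_diff) auto
  also have "\<bar>\<dots>\<bar> \<le> sum ?G (A \<times> A - V \<times> V)"
  proof (rule order_trans[OF sum_abs sum_mono])
    fix p assume "p \<in> A \<times> A - V \<times> V"
    then obtain x y where p: "p = (x, y)" "x \<in> A" "y \<in> A" by auto
    have "\<bar>f x - f y\<bar> * \<bar>g x - g y\<bar> \<le> (2 * d) * (2 * d)"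
      using f[OF p(2)] f[OF p(3)] g[OF p(2)] g[OF p(3)] by (intro mult_mono) linarith+
    then show "\<bar>?F p\<bar> \<le> ?G p"
      using w[OF p(2)] w[OF p(3)]
      by (simp add: p(1) abs_mult power2_eq_square mult_left_mono)
  qed
  also have "\<dots> \<le> sum ?G ((A - V) \<times> A \<union> A \<times> (A - V))"
    using A w by (intro sum_mono2) auto
  also have "\<dots> \<le> sum ?G ((A - V) \<times> A) + sum ?G (A \<times> (A - V))"
    using A w by (subst sum_Un) (auto intro!: sum_nonneg)
  also have "\<dots> = 8 * d\<^sup>2 * sum w A * sum w (A - V)"
    unfolding sum.cartesian_product[symmetric]
    by (simp add: sum_distrib_right[symmetric] sum_distrib_left[symmetric])
  finally show ?thesis .
qed

text \<open>Both covariances are compared with the common pair sum over \<open>V\<close>, where the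
  weights agree. Passing to \<open>V\<close> costs at most 8 d^2 \<delta> times the squared total
  mass on either side; the constants 4 and 20 come from \<open>Q \<le> 2 * P\<close>.\<close>

lemma wcov_compare:
  assumes A: "finite A" "V \<subseteq> A" and B: "finite B" "V \<subseteq> B"
    and wA: "\<And>x. x \<in> A \<Longrightarrow> w x \<ge> 0" and wB: "\<And>x. x \<in> B \<Longrightarrow> w' x \<ge> 0"
    and eq: "\<And>x. x \<in> V \<Longrightarrow> w x = w' x"
    and f: "\<And>x. x \<in> A \<union> B \<Longrightarrow> \<bar>f x\<bar> \<le> d" and g: "\<And>x. x \<in> A \<union> B \<Longrightarrow> \<bar>g x\<bar> \<le> d"
    and dA: "sum w (A - V) \<le> \<delta> * sum w A" and dB: "sum w' (B - V) \<le> \<delta> * sum w' B"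
    and \<delta>: "\<delta> \<le> 1/2" and pos: "sum w A > 0" "sum w' B > 0"
    and C: "wcov B w' f g \<le> C" "C \<ge> 0"
  shows "wcov A w f g \<le> 4 * C + 20 * d\<^sup>2 * \<delta>"
proof -
  define P Q where "P = sum w A" and "Q = sum w' B"
  have PQ: "P > 0" "Q > 0" using pos by (auto simp: P_def Q_def)
  have "0 \<le> sum w (A - V)" using wA by (intro sum_nonneg) auto
  then have \<delta>0: "\<delta> \<ge> 0" using dA pos zero_le_mult_iff[of \<delta> "sum w A"] by linarith
  have "sum w V = sum w' V" using eq by simp
  moreover have "sum w A = sum w V + sum w (A - V)" "sum w' B = sum w' V + sum w' (B - V)"
    using A B by (auto simp: sum.subset_diff)
  moreover have "\<delta> * Q \<le> 1/2 * Q" using \<delta> PQ by (intro mult_right_mono) auto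
  moreover have "0 \<le> sum w (A - V)" using wA by (intro sum_nonneg) auto
  \<comment> \<open>\<open>V\<close> carries at least half of \<open>Q\<close> and at most all of
    \<open>P\<close>.\<close>
  ultimately have QP: "Q \<le> 2 * P" using dB unfolding P_def Q_def by linarith
  have "pair_sum V w f g = pair_sum V w' f g"
    unfolding pair_sum_def using eq by (intro sum.cong) auto
  moreover have "pair_sum A w f g - pair_sum V w f g \<le> 8 * d\<^sup>2 * P * (\<delta> * P)"
  proof -
    have "pair_sum A w f g - pair_sum V w f g \<le> 8 * d\<^sup>2 * P * sum w (A - V)"
      unfolding P_def by (rule order_trans[OF abs_ge_self pair_sum_diff[OF A]]) (use wA f g in auto)
    also have "\<dots> \<le> 8 * d\<^sup>2 * P * (\<delta> * P)"
      using dA PQ unfolding P_def by (intro mult_left_mono) auto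
    finally show ?thesis .
  qed
  moreover have "pair_sum V w' f g - pair_sum B w' f g \<le> 8 * d\<^sup>2 * Q * (\<delta> * Q)"
  proof -
    have "pair_sum V w' f g - pair_sum B w' f g \<le> 8 * d\<^sup>2 * Q * sum w' (B - V)"
      unfolding Q_def by (rule order_trans[OF abs_ge_minus_self[of "pair_sum B w' f g - _", simplified] pair_sum_diff[OF B]])
        (use wB f g in auto)
    also have "\<dots> \<le> 8 * d\<^sup>2 * Q * (\<delta> * Q)"
      using dB PQ unfolding Q_def by (intro mult_left_mono) auto
    finally show ?thesis .
  qed
  ultimately have "pair_sum A w f g \<le> pair_sum B w' f g + 8 * d\<^sup>2 * \<delta> * (P\<^sup>2 + Q\<^sup>2)"
    by (simp add: algebra_simps power2_eq_square)
  also have "pair_sum B w' f g + 8 * d\<^sup>2 * \<delta> * (P\<^sup>2 + Q\<^sup>2)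
      \<le> 2 * Q\<^sup>2 * C + 8 * d\<^sup>2 * \<delta> * (P\<^sup>2 + Q\<^sup>2)"
    using pos C by (subst pair_sum_eq) (auto simp: Q_def intro!: mult_left_mono)
  also have "\<dots> \<le> 2 * (4 * P\<^sup>2) * C + 8 * d\<^sup>2 * \<delta> * (P\<^sup>2 + 4 * P\<^sup>2)"
  proof -
    have "Q\<^sup>2 \<le> (2 * P)\<^sup>2" using QP PQ by (intro power_mono) auto
    then have "Q\<^sup>2 \<le> 4 * P\<^sup>2" by (simp add: power_mult_distrib)
    then show ?thesis using C(2) \<delta>0 by (intro add_mono mult_right_mono mult_left_mono) auto
  qed
  also have "\<dots> = 2 * P\<^sup>2 * (4 * C + 20 * d\<^sup>2 * \<delta>)" by (simp add: algebra_simps)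
  finally have "2 * P\<^sup>2 * wcov A w f g \<le> 2 * P\<^sup>2 * (4 * C + 20 * d\<^sup>2 * \<delta>)"
    using pos by (subst (asm) pair_sum_eq) (auto simp: P_def)
  then show ?thesis using PQ by simp
qed

text \<open>Comparison with the empty set. This crude bound serves the finitely many small
  \<open>n\<close>.\<close>

lemma wcov_le_sup:
  assumes A: "finite A" and w: "\<And>x. x \<in> A \<Longrightarrow> w x \<ge> 0" and pos: "sum w A > 0"
    and f: "\<And>x. x \<in> A \<Longrightarrow> \<bar>f x\<bar> \<le> d" and g: "\<And>x. x \<in> A \<Longrightarrow> \<bar>g x\<bar> \<le> d"
  shows "wcov A w f g \<le> 4 * d\<^sup>2"
proof -
  have "2 * (sum w A)\<^sup>2 * wcov A w f g = pair_sum A w f g - pair_sum {} w f g"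
    using pos by (subst pair_sum_eq) (auto simp: pair_sum_def)
  also have "\<dots> \<le> 8 * d\<^sup>2 * sum w A * sum w (A - {})"
    using pair_sum_diff[OF A _ w f g, of "{}"] by (simp add: abs_le_iff)
  also have "\<dots> = 2 * (sum w A)\<^sup>2 * (4 * d\<^sup>2)" by (simp add: power2_eq_square)
  finally show ?thesis using pos by simp
qed

section \<open>Matrices as edge sets\<close>

definition edges :: "nat \<Rightarrow> nat set set" where
  "edges n = {e. e \<subseteq> {1..n} \<and> card e = 2}"

definition incident :: "nat \<Rightarrow> nat \<Rightarrow> nat set set" where
  "incident n i = {e \<in> edges n. i \<in> e}"

definition edge_deg :: "nat \<Rightarrow> nat \<Rightarrow> nat set set \<Rightarrow> real" where
  "edge_deg n i S = (\<Sum>e\<in>incident n i. if e \<in> S then 1 else -1)"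

definition to_config :: "nat \<Rightarrow> nat set set \<Rightarrow> nat \<Rightarrow> nat \<Rightarrow> real" where
  "to_config n S i j =
     (if i \<in> {1..n} \<and> j \<in> {1..n} \<and> i \<noteq> j then if {i, j} \<in> S then 1 else -1 else 0)"

lemma finite_edges [simp]: "finite (edges n)"
  by (rule finite_subset[of _ "Pow {1..n}"]) (auto simp: edges_def)

lemma finite_incident [simp]: "finite (incident n i)"
  by (simp add: incident_def)

lemma incident_subset: "incident n i \<subseteq> edges n"
  by (auto simp: incident_def)

lemma edge_finite: "e \<in> edges n \<Longrightarrow> finite e"
  by (auto simp: edges_def intro: finite_subset)

lemma pair_in_edges: "i \<in> {1..n} \<Longrightarrow> j \<in> {1..n} \<Longrightarrow> i \<noteq> j \<Longrightarrow> {i, j} \<in> edges n"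
  by (auto simp: edges_def)

lemma edge_cases:
  assumes "e \<in> edges n" "i \<in> e"
  obtains j where "e = {i, j}" "j \<noteq> i" "i \<in> {1..n}" "j \<in> {1..n}"
proof -
  have "card e = 2" "e \<subseteq> {1..n}" using assms by (auto simp: edges_def)
  then obtain a b where "e = {a, b}" "a \<noteq> b" by (auto simp: card_2_iff)
  then show ?thesis using assms(2) \<open>e \<subseteq> _\<close> that[of a] that[of b] by auto
qed

lemma incident_eq:
  assumes "i \<in> {1..n}"
  shows "incident n i = (\<lambda>j. {i, j}) ` ({1..n} - {i})"
proof
  show "incident n i \<subseteq> (\<lambda>j. {i, j}) ` ({1..n} - {i})"
  proof
    fix e assume "e \<in> incident n i"
    then have "e \<in> edges n" "i \<in> e" by (auto simp: incident_def)
    then obtain j where "e = {i, j}" "j \<noteq> i" "j \<in> {1..n}" by (rule edge_cases)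
    then show "e \<in> (\<lambda>j. {i, j}) ` ({1..n} - {i})" by auto
  qed
qed (use assms in \<open>auto simp: incident_def pair_in_edges\<close>)

lemma inj_incident: "inj_on (\<lambda>j. {i, j}) A"
  by (auto simp: inj_on_def doubleton_eq_iff)

lemma card_incident: "i \<in> {1..n} \<Longrightarrow> card (incident n i) = n - 1"
  by (simp add: incident_eq card_image inj_incident)

lemma card_incident_Int_incident:
  assumes "i \<noteq> j" shows "card (incident n i \<inter> incident n j) \<le> 1"
proof -
  have "e = {i, j}" if "e \<in> incident n i" "e \<in> incident n j" for e
  proof -
    from that have "e \<in> edges n" "i \<in> e" "j \<in> e" by (auto simp: incident_def)
    then show ?thesis using assms by (elim edge_cases[of e n i]) auto
  qed
  then have "incident n i \<inter> incident n j \<subseteq> {{i, j}}" by auto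
  from card_mono[OF _ this] show ?thesis by simp
qed

lemma deg_to_config:
  assumes "i \<in> {1..n}" shows "deg n i (to_config n S) = edge_deg n i S"
proof -
  have "deg n i (to_config n S) = (\<Sum>j\<in>{1..n} - {i}. if {i, j} \<in> S then 1 else -1)"
    unfolding deg_def using assms
    by (intro sum.mono_neutral_cong_right) (auto simp: to_config_def)
  also have "\<dots> = edge_deg n i S"
    unfolding edge_deg_def incident_eq[OF assms] by (subst sum.reindex) (simp_all add: inj_incident)
  finally show ?thesis .
qed

lemma bij_to_config: "bij_betw (to_config n) (Pow (edges n)) (configs n)"
proof (rule bij_betw_byWitness)
  let ?inv = "\<lambda>Y. {e. \<exists>i j. e = {i, j} \<and> i \<in> {1..n} \<and> j \<in> {1..n} \<and> i \<noteq> j \<and> Y i j = (1::real)}"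
  show "\<forall>S\<in>Pow (edges n). ?inv (to_config n S) = S"
  proof
    fix S assume S: "S \<in> Pow (edges n)"
    have "e \<in> ?inv (to_config n S)" if "e \<in> S" for e
    proof -
      have e: "e \<in> edges n" using S that by auto
      then have "card e = 2" by (simp add: edges_def)
      then obtain i where "i \<in> e" by fastforce
      with e obtain j where "e = {i, j}" "j \<noteq> i" "i \<in> {1..n}" "j \<in> {1..n}" by (rule edge_cases)
      then show ?thesis using that by (auto simp: to_config_def)
    qed
    moreover have "e \<in> S" if "e \<in> ?inv (to_config n S)" for e
      using that by (auto simp: to_config_def split: if_splits)
    ultimately show "?inv (to_config n S) = S" by blast
  qed
  show "\<forall>Y\<in>configs n. to_config n (?inv Y) = Y"
  proof (intro ballI ext)
    fix Y i j assume Y: "Y \<in> configs n"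
    then have sym: "Y i j = Y j i" by (simp add: configs_def)
    show "to_config n (?inv Y) i j = Y i j"
    proof (cases "i \<in> {1..n} \<and> j \<in> {1..n} \<and> i \<noteq> j")
      case True
      then have "Y i j \<in> {-1, 1}" using Y unfolding configs_def by blast
      moreover have "{i, j} \<in> ?inv Y \<longleftrightarrow> Y i j = 1"
        using True sym by (auto simp: doubleton_eq_iff)
      ultimately show ?thesis using True by (auto simp: to_config_def)
    next
      case False
      then have "Y i j = 0" using Y unfolding configs_def by blast
      then show ?thesis using False by (auto simp: to_config_def)
    qed
  qed
  show "to_config n ` Pow (edges n) \<subseteq> configs n"
    by (auto simp: configs_def to_config_def insert_commute split: if_splits)
  show "?inv ` configs n \<subseteq> Pow (edges n)"
    by (auto simp: pair_in_edges)
qed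

lemma edge_deg_insert:
  assumes "e \<in> edges n" "e \<notin> S"
  shows "edge_deg n i (insert e S) = edge_deg n i S + (if i \<in> e then 2 else 0)"
proof (cases "i \<in> e")
  case True
  then have e: "e \<in> incident n i" using assms by (simp add: incident_def)
  have "(\<Sum>x\<in>incident n i - {e}. if x \<in> insert e S then 1 else -1) =
    (\<Sum>x\<in>incident n i - {e}. if x \<in> S then 1 else - 1::real)"
    by (intro sum.cong) auto
  then show ?thesis
    using assms True unfolding edge_deg_def by (simp add: sum.remove[OF finite_incident e])
next
  case False
  then have e: "e \<notin> incident n i" by (simp add: incident_def)
  then have "(\<Sum>x\<in>incident n i. if x \<in> insert e S then 1 else -1) =
    (\<Sum>x\<in>incident n i. if x \<in> S then 1 else - 1::real)"
    by (intro sum.cong) auto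
  then show ?thesis using False by (simp add: edge_deg_def)
qed

lemma edge_deg_card:
  "edge_deg n i S = 2 * real (card (incident n i \<inter> S)) - real (card (incident n i))"
proof -
  have "edge_deg n i S = (\<Sum>e\<in>incident n i. 2 * of_bool (e \<in> S) - 1)"
    unfolding edge_deg_def by (intro sum.cong) auto
  also have "\<dots> = 2 * (\<Sum>e\<in>incident n i. of_bool (e \<in> S)) - real (card (incident n i))"
    by (simp add: sum_subtractf sum_distrib_left)
  also have "(\<Sum>e\<in>incident n i. of_bool (e \<in> S)) = real (card (incident n i \<inter> S))"
    by (simp add: Int_def)
  finally show ?thesis .
qed

lemma abs_edge_deg_le:
  assumes "i \<in> {1..n}" shows "\<bar>edge_deg n i S\<bar> \<le> real n"
proof -
  have "card (incident n i \<inter> S) \<le> card (incident n i)" by (intro card_mono) auto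
  moreover have "card (incident n i) \<le> n" using card_incident[OF assms] by simp
  ultimately show ?thesis unfolding edge_deg_card by linarith
qed

section \<open>Vertex potentials: growth of the weight and influence between edges\<close>

definition gibbs_weight :: "nat \<Rightarrow> (nat \<Rightarrow> real \<Rightarrow> real) \<Rightarrow> nat set set \<Rightarrow> real" where
  "gibbs_weight n \<phi> S = exp (\<Sum>i=1..n. \<phi> i (edge_deg n i S))"

text \<open>One flip from -1 to 1 raises a degree by 2, so this is the change of the potential at an
  endpoint of the flipped edge.\<close>

definition incr :: "(real \<Rightarrow> real) \<Rightarrow> real \<Rightarrow> real" where
  "incr \<phi> k = \<phi> (k + 2) - \<phi> k"

lemma gibbs_weight_pos [simp]: "gibbs_weight n \<phi> S > 0"
  by (simp add: gibbs_weight_def)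

lemma gibbs_gibbs_weight: "gibbs (edges n) (gibbs_weight n \<phi>)"
  by unfold_locales auto

lemma gibbs_weight_insert:
  assumes "e \<in> edges n" "e \<notin> S"
  shows "gibbs_weight n \<phi> (insert e S) =
    gibbs_weight n \<phi> S * exp (\<Sum>i\<in>e. incr (\<phi> i) (edge_deg n i S))"
proof -
  have e: "e \<subseteq> {1..n}" using assms by (simp add: edges_def)
  have "(\<Sum>i=1..n. \<phi> i (edge_deg n i (insert e S))) =
      (\<Sum>i=1..n. \<phi> i (edge_deg n i S)) +
      (\<Sum>i=1..n. if i \<in> e then incr (\<phi> i) (edge_deg n i S) else 0)"
    unfolding sum.distrib[symmetric]
    by (intro sum.cong) (auto simp: edge_deg_insert[OF assms] incr_def)
  also have "(\<Sum>i=1..n. if i \<in> e then incr (\<phi> i) (edge_deg n i S) else 0) =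
      (\<Sum>i\<in>e. incr (\<phi> i) (edge_deg n i S))"
    using e by (intro sum.mono_neutral_cong_right) auto
  finally show ?thesis by (simp add: gibbs_weight_def exp_add)
qed

text \<open>Rewrites an exponential rate as odds, so that growth rates can be compared with ratios
  of present to absent edges.\<close>

lemma exp_double_eq_tanh:
  fixes x :: real shows "exp (2 * x) = (1 + tanh x) / (1 - tanh x)"
proof -
  define q where "q = exp (- (2 * x))"
  have q: "q > 0" "exp (2 * x) = 1 / q" by (auto simp: q_def exp_minus field_simps)
  define r where "r = 1 + q"
  have r: "r > 0" using q(1) by (simp add: r_def)
  have t: "tanh x = (1 - q) / r" by (simp add: tanh_real_altdef q_def r_def)
  have "1 - tanh x = 2 * q / r" "1 + tanh x = 2 / r"
    unfolding t using r by (auto simp: r_def field_simps)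
  then have "(1 + tanh x) / (1 - tanh x) = (2 / r) / (2 * q / r)" by (simp only:)
  also have "\<dots> = 1 / q" using r by simp
  finally show ?thesis using q by simp
qed

text \<open>An edge has two endpoints, each of which gains at least \<open>2 * l\<close>, so the
  weight grows by at least exp (4 l), the odds belonging to relative degree
  \<open>tanh (2 * l)\<close>.\<close>

lemma gibbs_weight_growth:
  assumes "e \<in> edges n" "e \<notin> S" and l: "\<And>i. i \<in> e \<Longrightarrow> 2 * l \<le> incr (\<phi> i) (edge_deg n i S)"
  shows "(1 + tanh (2 * l)) / (1 - tanh (2 * l)) * gibbs_weight n \<phi> S
    \<le> gibbs_weight n \<phi> (insert e S)"
proof -
  have "2 * (2 * l) = (\<Sum>i\<in>e. 2 * l)" using assms(1) by (simp add: edges_def)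
  also have "\<dots> \<le> (\<Sum>i\<in>e. incr (\<phi> i) (edge_deg n i S))" by (intro sum_mono l)
  finally show ?thesis
    unfolding gibbs_weight_insert[OF assms(1,2)] exp_double_eq_tanh[symmetric] by simp
qed

lemma tanh_sq_less_1: "(tanh (x::real))\<^sup>2 < 1"
  using tanh_real_lt_1[of x] tanh_real_gt_neg1[of x] by (simp add: abs_square_less_1 abs_if)

text \<open>The derivative 1 - tanh^2 decreases on the nonnegative half-line, so its value at
  \<open>m\<close> bounds every slope beyond \<open>m\<close>.\<close>

lemma tanh_lipschitz:
  fixes x y m :: real
  assumes "0 \<le> m" "m \<le> x" "m \<le> y"
  shows "\<bar>tanh x - tanh y\<bar> \<le> (1 - (tanh m)\<^sup>2) * \<bar>x - y\<bar>"
proof -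
  have *: "tanh y - tanh x \<le> (1 - (tanh m)\<^sup>2) * (y - x)" if "m \<le> x" "x < y" for x y :: real
  proof -
    have "(tanh has_real_derivative 1 - (tanh u)\<^sup>2) (at u)" for u :: real
      by (auto intro!: derivative_eq_intros)
    from MVT2[OF that(2) this] obtain z
      where z: "x < z" "tanh y - tanh x = (y - x) * (1 - (tanh z)\<^sup>2)" by blast
    have "(tanh m)\<^sup>2 \<le> (tanh z)\<^sup>2"
      using z that assms(1) by (intro power_mono) auto
    then show ?thesis
      unfolding z(2) using that by (simp add: mult.commute mult_right_mono)
  qed
  have mono: "x \<le> y \<Longrightarrow> tanh x \<le> tanh y" for x y :: real by simp
  show ?thesis
    using *[of x y] *[of y x] assms mono[of x y] mono[of y x]
    by (cases x y rule: linorder_cases) auto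
qed

text \<open>The conditional log-odds of \<open>e\<close> is the sum of the two endpoint increments;
  the logistic function is written through tanh.\<close>

lemma up_eq_tanh:
  assumes "e \<in> edges n"
  shows "gibbs.up (gibbs_weight n \<phi>) e S =
    (1 + tanh ((\<Sum>i\<in>e. incr (\<phi> i) (edge_deg n i (S - {e}))) / 2)) / 2"
proof -
  interpret gibbs "edges n" "gibbs_weight n \<phi>" by (rule gibbs_gibbs_weight)
  define L where "L = (\<Sum>i\<in>e. incr (\<phi> i) (edge_deg n i (S - {e})))"
  define w where "w = gibbs_weight n \<phi> (S - {e})"
  have w: "w > 0" by (simp add: w_def)
  have ins: "gibbs_weight n \<phi> (insert e S) = w * exp L"
    using gibbs_weight_insert[OF assms, of "S - {e}" \<phi>] by (simp add: L_def w_def)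
  have "w * exp L + w = w * (exp L + 1)" by (simp add: algebra_simps)
  then have "up e S = exp L / (exp L + 1)"
    unfolding up_def ins w_def[symmetric] using w by simp
  also have "exp L = (1 + tanh (L / 2)) / (1 - tanh (L / 2))"
    using exp_double_eq_tanh[of "L / 2"] by simp
  also have "\<dots> / (\<dots> + 1) = (1 + tanh (L / 2)) / 2"
    using tanh_real_lt_1[of "L / 2"] by (simp add: field_simps)
  finally show ?thesis by (simp add: L_def)
qed

text \<open>Flipping \<open>g\<close> moves the log-odds of \<open>e\<close> only through shared
  vertices, by at most \<open>b\<close> each. Half the log-odds stays above \<open>2 * l\<close>,
  where \<open>tanh_lipschitz\<close> applies; the two halvings in \<open>up_eq_tanh\<close> give
  the factor 1/4.\<close>

lemma influence_bound:
  assumes e: "e \<in> edges n" and g: "g \<in> edges n" and "e \<noteq> g" and "0 \<le> l"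
    and lower: "\<And>i k. i \<in> {1..n} \<Longrightarrow> 2 * l \<le> incr (\<phi> i) k"
    and lip: "\<And>i k. i \<in> {1..n} \<Longrightarrow> \<bar>incr (\<phi> i) (k + 2) - incr (\<phi> i) k\<bar> \<le> b"
  shows "\<bar>gibbs.up (gibbs_weight n \<phi>) e (insert g S) - gibbs.up (gibbs_weight n \<phi>) e (S - {g})\<bar>
    \<le> (1 - (tanh (2 * l))\<^sup>2) / 4 * b * real (card (e \<inter> g))"
proof -
  define A where "A = S - {g} - {e}"
  have e': "e \<subseteq> {1..n}" "card e = 2" using e by (auto simp: edges_def)
  have sets: "insert g S - {e} = insert g A" "S - {g} - {e} = A" "g \<notin> A"
    using \<open>e \<noteq> g\<close> by (auto simp: A_def)
  define L where "L T = (\<Sum>i\<in>e. incr (\<phi> i) (edge_deg n i T))" for T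
  have L: "2 * l \<le> L T / 2" for T
  proof -
    have "2 * (2 * l) = (\<Sum>i\<in>e. 2 * l)" using e' by simp
    also have "\<dots> \<le> L T" unfolding L_def using e' by (intro sum_mono lower) auto
    finally show ?thesis by simp
  qed
  have "L (insert g A) - L A =
      (\<Sum>i\<in>e. if i \<in> g then incr (\<phi> i) (edge_deg n i A + 2) - incr (\<phi> i) (edge_deg n i A) else 0)"
    unfolding L_def sum_subtractf[symmetric]
    by (intro sum.cong) (auto simp: edge_deg_insert[OF g sets(3)])
  also have "\<dots> = (\<Sum>i\<in>e \<inter> g. incr (\<phi> i) (edge_deg n i A + 2) - incr (\<phi> i) (edge_deg n i A))"
    using edge_finite[OF e] by (simp add: sum.inter_restrict)
  also have "\<bar>\<dots>\<bar> \<le> (\<Sum>i\<in>e \<inter> g. b)"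
    using e' by (intro order_trans[OF sum_abs sum_mono] lip) auto
  finally have diff: "\<bar>L (insert g A) - L A\<bar> \<le> b * real (card (e \<inter> g))" by (simp add: mult.commute)
  have "\<bar>gibbs.up (gibbs_weight n \<phi>) e (insert g S) - gibbs.up (gibbs_weight n \<phi>) e (S - {g})\<bar>
      = \<bar>tanh (L (insert g A) / 2) - tanh (L A / 2)\<bar> / 2"
    unfolding up_eq_tanh[OF e] sets L_def[symmetric] by (simp add: add_divide_distrib diff_divide_distrib[symmetric])
  also have "\<dots> \<le> (1 - (tanh (2 * l))\<^sup>2) * \<bar>L (insert g A) / 2 - L A / 2\<bar> / 2"
    using \<open>0 \<le> l\<close> L by (intro divide_right_mono tanh_lipschitz) auto
  also have "\<dots> = (1 - (tanh (2 * l))\<^sup>2) / 4 * \<bar>L (insert g A) - L A\<bar>"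
    by (simp add: diff_divide_distrib[symmetric])
  also have "\<dots> \<le> (1 - (tanh (2 * l))\<^sup>2) / 4 * (b * real (card (e \<inter> g)))"
    using tanh_sq_less_1[of "2 * l"] by (intro mult_left_mono diff) simp
  finally show ?thesis by (simp add: mult.assoc)
qed

lemma edge_deg_osc:
  "osc_le (edges n) (edge_deg n i) (\<lambda>e. 2 * of_bool (i \<in> e))"
  unfolding osc_le_def
proof (intro ballI allI impI)
  fix e S assume e: "e \<in> edges n"
  have "edge_deg n i (insert e (S - {e})) = edge_deg n i (S - {e}) + (if i \<in> e then 2 else 0)"
    using e by (intro edge_deg_insert) auto
  then show "\<bar>edge_deg n i (insert e S) - edge_deg n i (S - {e})\<bar> \<le> 2 * of_bool (i \<in> e)"
    by simp
qed

lemma osc_le_shift: "osc_le E (\<lambda>S. h S - c) v \<longleftrightarrow> osc_le E h v"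
  by (simp add: osc_le_def)

lemma osc_le_mono: "osc_le E h v \<Longrightarrow> (\<And>e. e \<in> E \<Longrightarrow> v e \<le> v' e) \<Longrightarrow> osc_le E h v'"
  unfolding osc_le_def by (meson order_trans)

lemma sum_incident_weights:
  assumes "i \<in> {1..n}" "j \<in> {1..n}" "\<gamma> \<ge> 0" "n \<ge> 2"
  shows "(\<Sum>e\<in>incident n i. 2 * of_bool (j \<in> e) + \<gamma>)
    \<le> 2 * (if i = j then real n - 1 else 1) + (real n - 1) * \<gamma>"
proof -
  have "(\<Sum>e\<in>incident n i. of_bool (j \<in> e)) = (real (card (incident n i \<inter> incident n j)))"
    by (simp add: incident_def Int_def conj_ac)
  also have "\<dots> \<le> (if i = j then real n - 1 else 1)"
    using card_incident[OF assms(1)] card_incident_Int_incident[of i j n] assms(4) by (auto simp: of_nat_diff)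
  finally show ?thesis
    using card_incident[OF assms(1)] assms(4) by (simp add: sum.distrib sum_distrib_left[symmetric] of_nat_diff)
qed

text \<open>The weight \<open>v\<close> dominates the oscillation of the degree at \<open>j\<close>.
  Its small constant part \<open>\<gamma>\<close> absorbs the influence reaching edges away from
  \<open>j\<close>, yet over the n - 1 edges at \<open>i\<close> the weights add up to at most
  \<open>2 + g\<close>, of order one.\<close>

lemma gibbs_wcov_le:
  assumes ij: "i \<in> {1..n}" "j \<in> {1..n}" "i \<noteq> j" and n: "n \<ge> 2" and "0 \<le> l" "\<theta> > 0"
    and lower: "\<And>i k. i \<in> {1..n} \<Longrightarrow> 2 * l \<le> incr (\<phi> i) k"
    and lip: "\<And>i k. i \<in> {1..n} \<Longrightarrow> \<bar>incr (\<phi> i) (k + 2) - incr (\<phi> i) k\<bar> \<le> 4 * \<theta> / (real n - 1)"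
    and c_def: "c = \<theta> * (1 - (tanh (2 * l))\<^sup>2)" and c: "2 * c < 1"
  shows "wcov (Pow (edges n)) (gibbs_weight n \<phi>) (edge_deg n i) (edge_deg n j)
    \<le> (2 + 4 * c) / (1 - 2 * c)\<^sup>2"
proof -
  interpret gibbs "edges n" "gibbs_weight n \<phi>" by (rule gibbs_gibbs_weight)
  let ?w = "gibbs_weight n \<phi>"
  define m where "m = real n - 1"
  have m: "m \<ge> 1" using n by (simp add: m_def)
  have c0: "c > 0" using \<open>\<theta> > 0\<close> tanh_sq_less_1[of "2 * l"] by (simp add: c_def)
  \<comment> \<open>The midpoint between \<open>2 * c\<close> and 1.\<close>
  define \<kappa> where "\<kappa> = (1 + 2 * c) / 2"
  \<comment> \<open>Solves \<open>4 * c + 2 * c * g = \<kappa> * g\<close>, the balance required at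
    edges that avoid \<open>j\<close>.\<close>
  define g where "g = 8 * c / (1 - 2 * c)"
  define \<gamma> where "\<gamma> = g / m"
  have \<kappa>: "0 < \<kappa>" "\<kappa> < 1" "2 * c \<le> \<kappa>" using c c0 by (auto simp: \<kappa>_def)
  have g: "g \<ge> 0" "4 * c + 2 * c * g \<le> \<kappa> * g"
  proof -
    show "g \<ge> 0" using c c0 by (simp add: g_def)
    have "g * (1 - 2 * c) = 8 * c" using c by (simp add: g_def)
    then show "4 * c + 2 * c * g \<le> \<kappa> * g" by (simp add: \<kappa>_def algebra_simps)
  qed
  have \<gamma>: "\<gamma> \<ge> 0" "m * \<gamma> = g" using g m by (auto simp: \<gamma>_def)
  define v where "v e = 2 * of_bool (j \<in> e) + \<gamma>" for e :: "nat set"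
  define C where "C e f = c / m * real (card (e \<inter> f))" for e f :: "nat set"
  define Z where "Z = sum ?w (Pow (edges n))"
  have Z: "Z > 0" unfolding Z_def by (intro sum_pos) auto
  have row: "(\<Sum>e\<in>incident n k. v e) \<le> 2 * (if k = j then m else 1) + g" if "k \<in> {1..n}" for k
    using sum_incident_weights[OF that ij(2) \<gamma>(1) n] \<gamma>(2) unfolding v_def m_def by simp
  have "\<bar>\<Sum>S\<in>Pow (edges n). ?w S * (edge_deg n i S - wmean (Pow (edges n)) ?w (edge_deg n i)) * edge_deg n j S\<bar>
    \<le> (\<Sum>e\<in>edges n. 2 * of_bool (i \<in> e) * v e) / (4 * (1 - \<kappa>)) * sum ?w (Pow (edges n))"
  proof (rule dobrushin_covariance)
    show "osc_le (edges n) (\<lambda>S. edge_deg n i S - wmean (Pow (edges n)) ?w (edge_deg n i)) (\<lambda>e. 2 * of_bool (i \<in> e))"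
      unfolding osc_le_shift by (rule edge_deg_osc)
    show "osc_le (edges n) (edge_deg n j) v"
      by (rule osc_le_mono[OF edge_deg_osc]) (simp add: v_def \<gamma>)
    show "edges n \<noteq> {}" using pair_in_edges[OF ij] by auto
    have "wmean (Pow (edges n)) ?w (edge_deg n i) * Z = (\<Sum>S\<in>Pow (edges n). ?w S * edge_deg n i S)"
      using Z by (simp add: wmean_def Z_def)
    then show "(\<Sum>S\<in>Pow (edges n). ?w S * (edge_deg n i S - wmean (Pow (edges n)) ?w (edge_deg n i))) = 0"
      by (simp add: right_diff_distrib sum_subtractf sum_distrib_right[symmetric] Z_def mult.commute)
    show "\<bar>up e (insert f S) - up e (S - {f})\<bar> \<le> C e f"
      if "e \<in> edges n" "f \<in> edges n" "e \<noteq> f" for e f S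
    proof -
      have "\<bar>up e (insert f S) - up e (S - {f})\<bar>
          \<le> (1 - (tanh (2 * l))\<^sup>2) / 4 * (4 * \<theta> / (real n - 1)) * real (card (e \<inter> f))"
        by (rule influence_bound[OF that(1-3) \<open>0 \<le> l\<close> lower lip])
      also have "\<dots> = C e f"
        unfolding C_def c_def m_def[symmetric] using m by (simp add: field_simps)
      finally show ?thesis .
    qed
    show "(\<Sum>e\<in>edges n - {f}. C e f * v e) \<le> \<kappa> * v f" if f: "f \<in> edges n" for f
    proof -
      have v0: "v e \<ge> 0" for e using \<gamma> by (simp add: v_def)
      have f': "f \<subseteq> {1..n}" "card f = 2" using f by (auto simp: edges_def)
      \<comment> \<open>Counting \<open>card (e \<inter> f)\<close> through the endpoints of
        \<open>f\<close> reduces the influence sum to two row sums.\<close>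
      have "(\<Sum>e\<in>edges n. \<Sum>k\<in>f. if k \<in> e then v e else 0) = (\<Sum>k\<in>f. \<Sum>e\<in>incident n k. v e)"
        unfolding incident_def by (subst sum.swap) (simp add: sum.inter_filter)
      also have "\<dots> \<le> (\<Sum>k\<in>f. 2 * (if k = j then m else 1) + g)"
        using f' by (intro sum_mono row) auto
      \<comment> \<open>Only the row of \<open>j\<close> has many edges of weight about 2; every
        other row has just one.\<close>
      also have "\<dots> = (if j \<in> f then 2 * m + 2 else 4) + 2 * g"
      proof (cases "j \<in> f")
        case True
        from f True obtain k where "f = {j, k}" "k \<noteq> j" by (rule edge_cases)
        then show ?thesis by simp
      next
        case False
        then have "(\<Sum>k\<in>f. 2 * (if k = j then m else 1) + g) = (\<Sum>k\<in>f. 2 + g)"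
          by (intro sum.cong) auto
        then show ?thesis using False f' by simp
      qed
      finally have "(\<Sum>e\<in>edges n. \<Sum>k\<in>f. if k \<in> e then v e else 0)
        \<le> (if j \<in> f then 2 * m + 2 else 4) + 2 * g" .
      then have "c / m * (\<Sum>e\<in>edges n. \<Sum>k\<in>f. if k \<in> e then v e else 0)
        \<le> c / m * ((if j \<in> f then 2 * m + 2 else 4) + 2 * g)"
        using c0 m by (intro mult_left_mono) auto
      note * = this
      have "(\<Sum>e\<in>edges n - {f}. C e f * v e) \<le> (\<Sum>e\<in>edges n. C e f * v e)"
      proof (rule sum_mono2)
        show "0 \<le> C e f * v e" for e
          unfolding C_def using v0[of e] c0 m by (intro mult_nonneg_nonneg divide_nonneg_nonneg) auto
      qed auto
      also have "\<dots> = c / m * (\<Sum>e\<in>edges n. \<Sum>k\<in>f. if k \<in> e then v e else 0)"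
      proof -
        have "real (card (e \<inter> f)) * v e = (\<Sum>k\<in>f. if k \<in> e then v e else 0)" for e
          by (subst sum.inter_restrict[symmetric]) (simp_all add: Int_commute edge_finite[OF f])
        then have "C e f * v e = c / m * (\<Sum>k\<in>f. if k \<in> e then v e else 0)" for e
          by (simp only: C_def mult.assoc)
        then show ?thesis by (simp only: sum_distrib_left)
      qed
      also note *
      also have "c / m * ((if j \<in> f then 2 * m + 2 else 4) + 2 * g) \<le> \<kappa> * v f"
      proof (cases "j \<in> f")
        case True
        \<comment> \<open>The terms without \<open>\<gamma>\<close> total at most
          \<open>4 * c\<close>, which the part \<open>2 * \<kappa>\<close> of
          \<open>\<kappa> * v f\<close> covers.\<close>
        have "c / m * (2 * m + 2 + 2 * g) = 2 * c + 2 * c / m + 2 * c * \<gamma>"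
          using m by (simp add: \<gamma>_def field_simps)
        moreover have "2 * c / m \<le> 2 * c / 1" using m c0 by (intro divide_left_mono) auto
        moreover have "2 * c * \<gamma> \<le> \<kappa> * \<gamma>" using \<kappa> \<gamma> by (intro mult_right_mono)
        ultimately have "c / m * (2 * m + 2 + 2 * g) \<le> \<kappa> * (2 + \<gamma>)"
          using \<kappa>(3) by (simp add: distrib_left)
        then show ?thesis using True by (simp add: v_def)
      next
        case False
        have "c / m * (4 + 2 * g) = (4 * c + 2 * c * g) / m" using m by (simp add: field_simps)
        also have "\<dots> \<le> \<kappa> * g / m" using g m by (intro divide_right_mono) auto
        finally show ?thesis using False by (simp add: v_def \<gamma>_def)
      qed
      finally show ?thesis .
    qed
  qed (use \<kappa> in auto)
  also have "(\<Sum>e\<in>edges n. 2 * of_bool (i \<in> e) * v e) = 2 * (\<Sum>e\<in>incident n i. v e)"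
    unfolding incident_def sum_distrib_left by (subst sum.inter_filter) (auto intro!: sum.cong)
  also have "\<dots> / (4 * (1 - \<kappa>)) * sum ?w (Pow (edges n)) \<le> 2 * (2 + g) / (4 * (1 - \<kappa>)) * Z"
    using row[OF ij(1)] ij(3) \<kappa> Z
    by (auto simp: Z_def intro!: mult_right_mono divide_right_mono)
  also have "2 * (2 + g) / (4 * (1 - \<kappa>)) = (2 + 4 * c) / (1 - 2 * c)\<^sup>2"
  proof -
    define D where "D = 1 - 2 * c"
    have "2 + g = (2 * D + 8 * c) / D"
      using c by (simp add: g_def D_def[symmetric] add_divide_distrib) (simp add: D_def)
    also have "2 * D + 8 * c = 2 + 4 * c" by (simp add: D_def)
    finally have g: "2 + g = (2 + 4 * c) / D" .
    have "4 * (1 - \<kappa>) = 2 * D" by (simp add: \<kappa>_def D_def field_simps)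
    with g have "2 * (2 + g) / (4 * (1 - \<kappa>)) = 2 * ((2 + 4 * c) / D) / (2 * D)" by (simp only:)
    also have "2 * (x / D) / (2 * D) = x / D\<^sup>2" for x by (simp add: power2_eq_square)
    finally show ?thesis by (simp only: D_def)
  qed
  finally have "(\<Sum>S\<in>Pow (edges n). ?w S * (edge_deg n i S - wmean (Pow (edges n)) ?w (edge_deg n i)) * edge_deg n j S)
      \<le> (2 + 4 * c) / (1 - 2 * c)\<^sup>2 * Z" by linarith
  then show ?thesis
    using Z by (subst wcov_right_centred) (auto simp: Z_def pos_divide_le_eq)
qed

section \<open>Lower tails of the degrees\<close>

text \<open>With \<open>r\<close> equal to half the positive root this is the event U in terms of
  edge sets.\<close>

definition above :: "nat \<Rightarrow> real \<Rightarrow> nat set set set" where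
  "above n r = {S. S \<subseteq> edges n \<and> (\<forall>i\<in>{1..n}. (real n - 1) * r \<le> edge_deg n i S)}"

lemma above_subset: "above n r \<subseteq> Pow (edges n)"
  by (auto simp: above_def)

lemma finite_above [simp]: "finite (above n r)"
  by (rule finite_subset[OF above_subset]) simp

lemma above_mono: "r \<le> s \<Longrightarrow> n \<ge> 1 \<Longrightarrow> above n s \<subseteq> above n r"
  unfolding above_def using mult_left_mono[of r s "real n - 1"] by (auto intro: order_trans)

lemma above_insert: "S \<in> above n r \<Longrightarrow> e \<in> edges n \<Longrightarrow> insert e S \<in> above n r"
proof (cases "e \<in> S")
  case False
  moreover assume "S \<in> above n r" "e \<in> edges n"
  ultimately show ?thesis by (force simp: above_def edge_deg_insert)
qed (simp add: insert_absorb)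

text \<open>The ratio \<open>(1 + x) / (1 - x)\<close> of present to absent edges at a vertex of relative degree
  \<open>x\<close> is compared with the growth rate \<open>(1 + G) / (1 - G)\<close>.\<close>

lemma growth_ratio:
  fixes x G \<eta> :: real
  assumes "0 \<le> x" "0 < \<eta>" "x + \<eta> \<le> G" "G < 1"
  shows "1 + x \<le> (1 - \<eta>) * ((1 + G) / (1 - G)) * (1 - x)"
proof -
  have "(1 + x) * (1 - G) \<le> (1 - \<eta>) * (1 + G) * (1 - x)"
  proof -
    \<comment> \<open>The difference (1 + G)(1 - x) - (1 + x)(1 - G) equals 2 (G - x), so this much
      is available to pay for the factor \<open>1 - \<eta>\<close>.\<close>
    have "\<eta> * ((1 + G) * (1 - x)) \<le> (G - x) * 2"
    proof (rule mult_mono)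
      have "(1 + G) * (1 - x) \<le> 2 * 1" using assms by (intro mult_mono) auto
      then show "(1 + G) * (1 - x) \<le> 2" by simp
    qed (use assms in auto)
    then show ?thesis by (simp add: algebra_simps)
  qed
  then have "(1 + x) * (1 - G) / (1 - G) \<le> (1 - \<eta>) * (1 + G) * (1 - x) / (1 - G)"
    using assms by (intro divide_right_mono) auto
  then show ?thesis using assms by simp
qed

text \<open>While the relative degree at \<open>i\<close> is at most
  \<open>y + \<epsilon> / 2\<close>, the gain in weight from adding an edge outweighs the ratio of
  present to absent edges, by \<open>growth_ratio\<close>. The roughly (n - 1) \<epsilon> / 4 edge
  counts between \<open>y\<close> and \<open>y + \<epsilon> / 2\<close> each yield a factor
  \<open>1 - \<epsilon> / 2\<close>.\<close>

lemma degree_tail: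
  assumes i: "i \<in> {1..n}" and V: "\<V> \<subseteq> Pow (edges n)"
    and up_closed: "\<And>S e. S \<in> \<V> \<Longrightarrow> e \<in> edges n \<Longrightarrow> insert e S \<in> \<V>"
    and l: "\<And>S k. S \<in> \<V> \<Longrightarrow> k \<in> {1..n} \<Longrightarrow> 2 * l \<le> incr (\<phi> k) (edge_deg n k S)"
    and y: "0 \<le> y" "0 < \<epsilon>" "y + \<epsilon> \<le> tanh (2 * l)"
  shows "(\<Sum>S | S \<in> \<V> \<and> edge_deg n i S < (real n - 1) * y. gibbs_weight n \<phi> S)
    \<le> (1 - \<epsilon> / 2) ^ nat \<lfloor>(real n - 1) * \<epsilon> / 4\<rfloor> * sum (gibbs_weight n \<phi>) \<V>"
proof -
  interpret gibbs "edges n" "gibbs_weight n \<phi>" by (rule gibbs_gibbs_weight)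
  define G where "G = tanh (2 * l)"
  have G: "G < 1" using tanh_real_lt_1 by (simp add: G_def)
  define R where "R = (1 + G) / (1 - G)"
  define d where "d = real n - 1"
  have d: "real (card (incident n i)) = d" "d \<ge> 0"
    using i card_incident[OF i] by (auto simp: d_def of_nat_diff)
  have yG: "0 \<le> y" "y + \<epsilon> \<le> G" "\<epsilon> < 1" using y G by (auto simp: G_def)
  have R: "R > 0" using yG y G by (simp add: R_def)
  \<comment> \<open>Number of present edges at relative degree \<open>y\<close>; the ceiling turns
    the strict inequality between reals into one between naturals.\<close>
  define a where "a = nat \<lceil>d * (1 + y) / 2\<rceil>"
  \<comment> \<open>This many further edges raise the relative degree by at most
    \<open>\<epsilon> / 2\<close>.\<close>
  define m where "m = nat \<lfloor>d * \<epsilon> / 4\<rfloor>"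
  have a_le: "real a < d * (1 + y) / 2 + 1" unfolding a_def using d yG
    by (simp add: of_nat_nat) linarith
  have "real m = of_int \<lfloor>d * \<epsilon> / 4\<rfloor>" using d y by (simp add: m_def)
  then have m_le: "real m \<le> d * \<epsilon> / 4" using of_int_floor_le[of "d * \<epsilon> / 4"] by linarith
  have "d * (1 + y) / 2 + d * \<epsilon> / 4 = d * ((1 + y) / 2 + \<epsilon> / 4)" by (simp add: algebra_simps)
  also have "\<dots> \<le> d * 1"
  proof (rule mult_left_mono)
    show "(1 + y) / 2 + \<epsilon> / 4 \<le> 1" using yG y(2) G by argo
  qed (rule d)
  finally have am: "real (a + m) < d + 1" using a_le m_le by simp
  have eq: "edge_deg n i S < d * y \<longleftrightarrow> card (incident n i \<inter> S) < a" for S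
  proof -
    have "edge_deg n i S < d * y \<longleftrightarrow> real (card (incident n i \<inter> S)) < d * (1 + y) / 2"
      unfolding edge_deg_card d by (auto simp: algebra_simps)
    also have "\<dots> \<longleftrightarrow> int (card (incident n i \<inter> S)) < \<lceil>d * (1 + y) / 2\<rceil>"
      by (simp add: less_ceiling_iff)
    also have "\<dots> \<longleftrightarrow> card (incident n i \<inter> S) < a" by (simp add: a_def zless_nat_eq_int_zless)
    finally show ?thesis .
  qed
  have "(\<Sum>S | S \<in> \<V> \<and> card (incident n i \<inter> S) < a. gibbs_weight n \<phi> S)
      \<le> (1 - \<epsilon> / 2) ^ m * sum (gibbs_weight n \<phi>) \<V>"
  proof (rule lift_iterate[OF V incident_subset, where R = R])
    show "insert e S \<in> \<V>" if "S \<in> \<V>" "e \<in> incident n i - S" for S e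
      using up_closed that incident_subset by blast
    show "R * gibbs_weight n \<phi> S \<le> gibbs_weight n \<phi> (insert e S)"
      if "S \<in> \<V>" "e \<in> incident n i - S" for S e
      unfolding R_def G_def
    proof (rule gibbs_weight_growth)
      show e: "e \<in> edges n" "e \<notin> S" using that by (auto simp: incident_def)
      show "2 * l \<le> incr (\<phi> k) (edge_deg n k S)" if "k \<in> e" for k
        using l[OF \<open>S \<in> \<V>\<close>, of k] that e by (auto simp: edges_def)
    qed
    show "real b \<le> (1 - \<epsilon> / 2) * (R * (real (card (incident n i)) - real b))" if "a \<le> b" "b < a + m" for b
    proof -
      define x where "x = y + \<epsilon> / 2"
      \<comment> \<open>The strict inequality \<open>b < a + m\<close> supplies the unit lost in
        rounding \<open>a\<close> up.\<close>
      have "real b + 1 \<le> real (a + m)" using that by linarith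
      then have "2 * real b \<le> d * (1 + y) + d * \<epsilon> / 2"
        using a_le m_le unfolding of_nat_add by argo
      then have b: "2 * real b \<le> d * (1 + x)" by (simp add: x_def algebra_simps)
      have "1 + x \<le> (1 - \<epsilon> / 2) * R * (1 - x)"
        unfolding R_def using yG y G by (intro growth_ratio) (auto simp: x_def)
      then have "d * (1 + x) \<le> d * ((1 - \<epsilon> / 2) * R * (1 - x))"
        using d by (intro mult_left_mono)
      also have "\<dots> = (1 - \<epsilon> / 2) * R * (2 * d - d * (1 + x))" by (simp add: algebra_simps)
      also have "\<dots> \<le> (1 - \<epsilon> / 2) * R * (2 * d - 2 * real b)"
        using b R yG by (intro mult_left_mono) auto
      finally show ?thesis using b unfolding d by (simp add: algebra_simps)
    qed
    show "a + m \<le> card (incident n i)"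
      using am d by linarith
  qed (use R yG in auto)
  then show ?thesis by (simp add: eq m_def d_def[symmetric])
qed

text \<open>Union bound over the vertices with \<open>degree_tail\<close>.\<close>

lemma min_degree_tail:
  assumes V: "\<V> \<subseteq> Pow (edges n)"
    and up_closed: "\<And>S e. S \<in> \<V> \<Longrightarrow> e \<in> edges n \<Longrightarrow> insert e S \<in> \<V>"
    and l: "\<And>S k. S \<in> \<V> \<Longrightarrow> k \<in> {1..n} \<Longrightarrow> 2 * l \<le> incr (\<phi> k) (edge_deg n k S)"
    and y: "0 \<le> y" "0 < \<epsilon>" "y + \<epsilon> \<le> tanh (2 * l)"
  shows "sum (gibbs_weight n \<phi>) (\<V> - above n y)
    \<le> real n * (1 - \<epsilon> / 2) ^ nat \<lfloor>(real n - 1) * \<epsilon> / 4\<rfloor> * sum (gibbs_weight n \<phi>) \<V>"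
proof -
  have fin: "finite \<V>" using V by (rule finite_subset) simp
  let ?w = "gibbs_weight n \<phi>"
  let ?P = "\<lambda>i S. edge_deg n i S < (real n - 1) * y"
  have "sum ?w (\<V> - above n y) \<le> (\<Sum>S\<in>\<V> - above n y. \<Sum>i\<in>{1..n}. if ?P i S then ?w S else 0)"
  proof (rule sum_mono)
    fix S assume "S \<in> \<V> - above n y"
    then obtain i where i: "i \<in> {1..n}" "?P i S" using V by (auto simp: above_def not_le)
    have "(if ?P i S then ?w S else 0) \<le> (\<Sum>i\<in>{1..n}. if ?P i S then ?w S else 0)"
      by (rule member_le_sum[OF i(1)]) (auto simp: less_imp_le)
    then show "?w S \<le> (\<Sum>i\<in>{1..n}. if ?P i S then ?w S else 0)" using i by simp
  qed
  also have "\<dots> \<le> (\<Sum>S\<in>\<V>. \<Sum>i\<in>{1..n}. if ?P i S then ?w S else 0)"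
    using fin by (intro sum_mono2) (auto intro!: sum_nonneg simp: less_imp_le)
  also have "\<dots> = (\<Sum>i\<in>{1..n}. \<Sum>S | S \<in> \<V> \<and> ?P i S. ?w S)"
    using fin by (subst sum.swap) (simp add: sum.inter_filter)
  also have "\<dots> \<le> (\<Sum>i\<in>{1..n}. (1 - \<epsilon> / 2) ^ nat \<lfloor>(real n - 1) * \<epsilon> / 4\<rfloor> * sum (gibbs_weight n \<phi>) \<V>)"
    by (intro sum_mono degree_tail[where l = l] V up_closed l y)
  finally show ?thesis by simp
qed

text \<open>Each round starts from \<open>above n r\<close>, where all increments are at least
  \<open>2 * (\<theta> * r)\<close>. Half of the gap \<open>2 * \<epsilon>\<close> raises the
  threshold, the other half remains as the margin of \<open>min_degree_tail\<close>; the failure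
  weights add up over the \<open>q\<close> rounds.\<close>

lemma min_degree_bootstrap:
  assumes n: "n \<ge> 1" and \<epsilon>: "0 < \<epsilon>" "\<epsilon> \<le> 1" and r0: "0 \<le> r\<^sub>0" "r\<^sub>0 \<le> s"
    and gap: "\<And>r. r\<^sub>0 \<le> r \<Longrightarrow> r \<le> s \<Longrightarrow> r + 2 * \<epsilon> \<le> tanh (2 * \<theta> * r)"
    and growth: "\<And>i r k. i \<in> {1..n} \<Longrightarrow> (real n - 1) * r \<le> k \<Longrightarrow> 2 * (\<theta> * r) \<le> incr (\<phi> i) k"
  shows "sum (gibbs_weight n \<phi>) (above n r\<^sub>0 - above n (min s (r\<^sub>0 + real q * \<epsilon>)))
    \<le> real q * (real n * (1 - \<epsilon> / 2) ^ nat \<lfloor>(real n - 1) * \<epsilon> / 4\<rfloor>) * sum (gibbs_weight n \<phi>) (above n r\<^sub>0)"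
proof (induction q)
  case 0
  then show ?case using r0 by simp
next
  case (Suc q)
  let ?w = "gibbs_weight n \<phi>"
  define \<delta> where "\<delta> = real n * (1 - \<epsilon> / 2) ^ nat \<lfloor>(real n - 1) * \<epsilon> / 4\<rfloor>"
  have \<delta>: "\<delta> \<ge> 0" using \<epsilon> by (simp add: \<delta>_def)
  define r y where "r = min s (r\<^sub>0 + real q * \<epsilon>)" and "y = min s (r\<^sub>0 + real (Suc q) * \<epsilon>)"
  have r: "r\<^sub>0 \<le> r" "r \<le> s" using r0 \<epsilon> by (auto simp: r_def)
  have y: "0 \<le> y" "y \<le> r + \<epsilon>" using r0 \<epsilon> by (auto simp: r_def y_def algebra_simps)
  have "sum ?w (above n r - above n y) \<le> \<delta> * sum ?w (above n r)"
    unfolding \<delta>_def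
  proof (rule min_degree_tail[where l = "\<theta> * r"])
    show "y + \<epsilon> \<le> tanh (2 * (\<theta> * r))" using gap[OF r] y by (simp add: mult.assoc)
    show "2 * (\<theta> * r) \<le> incr (\<phi> k) (edge_deg n k S)" if "S \<in> above n r" "k \<in> {1..n}" for S k
      using that by (intro growth) (auto simp: above_def)
  qed (use y \<epsilon> above_subset above_insert in auto)
  also have "\<dots> \<le> \<delta> * sum ?w (above n r\<^sub>0)"
    using above_mono[OF r(1) n] \<delta> by (intro mult_left_mono sum_mono2) (auto simp: less_imp_le)
  finally have "sum ?w (above n r - above n y) \<le> \<delta> * sum ?w (above n r\<^sub>0)" .
  moreover have "sum ?w (above n r\<^sub>0 - above n r) \<le> real q * \<delta> * sum ?w (above n r\<^sub>0)"
    using Suc.IH by (simp add: r_def \<delta>_def)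
  moreover have "sum ?w (above n r\<^sub>0 - above n y)
      \<le> sum ?w (above n r\<^sub>0 - above n r) + sum ?w (above n r - above n y)"
  proof -
    have "sum ?w (above n r\<^sub>0 - above n y) \<le> sum ?w ((above n r\<^sub>0 - above n r) \<union> (above n r - above n y))"
      by (intro sum_mono2) (auto simp: less_imp_le)
    also have "\<dots> = sum ?w (above n r\<^sub>0 - above n r) + sum ?w (above n r - above n y)"
      by (intro sum.union_disjoint) auto
    finally show ?thesis .
  qed
  ultimately have "sum ?w (above n r\<^sub>0 - above n y) \<le> real (Suc q) * \<delta> * sum ?w (above n r\<^sub>0)"
    by (simp add: algebra_simps)
  then show ?case by (simp add: y_def \<delta>_def)
qed

section \<open>The two-star weight and its linearisation\<close>

text \<open>The function tanh (2 \<theta> x) - x is strictly concave for x > 0 and vanishes at 0 and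
  \<open>t\<close>. Hence it is positive in between and its slope is negative close to
  \<open>t\<close>; \<open>s\<close> is taken there, and \<open>\<epsilon>\<close> from the minimum
  over [t/2, s].\<close>

lemma tanh_gap:
  fixes \<theta> :: real
  assumes "\<theta> > 1/2" and t: "t = pos_root \<theta>"
  obtains s \<epsilon> where "t / 2 \<le> s" "0 < \<epsilon>" "\<epsilon> \<le> 1"
    and "2 * (\<theta> * (1 - (tanh (2 * (\<theta> * s)))\<^sup>2)) < 1"
    and "\<And>r. t / 2 \<le> r \<Longrightarrow> r \<le> s \<Longrightarrow> r + 2 * \<epsilon> \<le> tanh (2 * \<theta> * r)"
proof -
  have t: "0 < t" "t = tanh (2 * \<theta> * t)" using pos_root[OF assms(1)] t by auto
  define f where "f x = tanh (2 * \<theta> * x) - x" for x :: real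
  define f' where "f' x = (1 - (tanh (2 * \<theta> * x))\<^sup>2) * (2 * \<theta>) - 1" for x :: real
  have df: "(f has_real_derivative f' x) (at x)" for x
    unfolding f_def f'_def by (auto intro!: derivative_eq_intros)
  have f0: "f 0 = 0" "f t = 0" using t by (auto simp: f_def)
  have f'_less: "f' y < f' x" if "0 < x" "x < y" for x y
  proof -
    have "(tanh (2 * \<theta> * x))\<^sup>2 < (tanh (2 * \<theta> * y))\<^sup>2"
      using that assms(1) by (intro power_strict_mono) auto
    then show ?thesis using assms(1) by (simp add: f'_def)
  qed
  have mvt: "\<exists>z. x < z \<and> z < y \<and> f y - f x = (y - x) * f' z" if "x < y" for x y
    using MVT2[OF that, of f f'] df by blast
  have pos: "f x > 0" if x: "0 < x" "x < t" for x
  proof (rule ccontr)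
    assume neg: "\<not> f x > 0"
    \<comment> \<open>A nonpositive value at \<open>x\<close> would force a slope at most 0 before
      \<open>x\<close> and at least 0 after it, although \<open>f'\<close> strictly
      decreases.\<close>
    obtain a where a: "0 < a" "a < x" "f x - f 0 = (x - 0) * f' a"
      using mvt[OF x(1)] by blast
    obtain b where b: "x < b" "b < t" "f t - f x = (t - x) * f' b"
      using mvt[OF x(2)] by blast
    have "x * f' a \<le> 0" "0 \<le> (t - x) * f' b" using a b f0 neg by auto
    then have "f' a \<le> 0" "0 \<le> f' b" using x by (auto simp: mult_le_0_iff zero_le_mult_iff)
    then show False using f'_less[of a b] a b by linarith
  qed
  obtain \<xi> where \<xi>: "0 < \<xi>" "\<xi> < t" "f t - f 0 = (t - 0) * f' \<xi>"
    using mvt[OF t(1)] by blast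
  then have "f' \<xi> = 0" using f0 t(1) by simp
  \<comment> \<open>Past the critical point \<open>\<xi>\<close> the slope is negative, which is
    exactly the contraction condition at \<open>s\<close>.\<close>
  obtain s where s: "max \<xi> (t / 2) < s" "s < t"
    using dense[of "max \<xi> (t / 2)" t] \<xi> t(1) by auto
  have "f' s < 0" using f'_less[of \<xi> s] \<xi> s \<open>f' \<xi> = 0\<close> by simp
  have "continuous_on {t / 2..s} f"
    using df by (intro DERIV_continuous_on) (auto intro: has_field_derivative_at_within)
  then obtain u where u: "u \<in> {t / 2..s}" "\<And>r. r \<in> {t / 2..s} \<Longrightarrow> f u \<le> f r"
    using continuous_attains_inf[of "{t / 2..s}" f] s by auto
  have fu: "f u > 0" using u s t(1) by (intro pos) auto
  show ?thesis
  proof (rule that[of s "min 1 (f u / 2)"])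
    show "2 * (\<theta> * (1 - (tanh (2 * (\<theta> * s)))\<^sup>2)) < 1"
      using \<open>f' s < 0\<close> by (simp add: f'_def algebra_simps)
    show "r + 2 * min 1 (f u / 2) \<le> tanh (2 * \<theta> * r)" if "t / 2 \<le> r" "r \<le> s" for r
      using u(2)[of r] that by (simp add: f_def min_def field_simps)
  qed (use s fu in auto)
qed

text \<open>The constant \<open>- \<theta> / 2\<close> is the share of one vertex in the subtracted
  total \<theta> n / 2.\<close>

definition two_star :: "nat \<Rightarrow> real \<Rightarrow> (nat \<Rightarrow> real) \<Rightarrow> nat \<Rightarrow> real \<Rightarrow> real" where
  "two_star n \<theta> \<beta> i k = \<theta> / (2 * (real n - 1)) * k\<^sup>2 - \<theta> / 2 + \<beta> i / 2 * k"

text \<open>The square \<open>k\<^sup>2\<close> is replaced below the level \<open>K = (n - 1) s\<close> by its tangent at \<open>K\<close>.\<close>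

definition linearised_two_star ::
    "nat \<Rightarrow> real \<Rightarrow> (nat \<Rightarrow> real) \<Rightarrow> real \<Rightarrow> nat \<Rightarrow> real \<Rightarrow> real" where
  "linearised_two_star n \<theta> \<beta> s i k = (let K = (real n - 1) * s in
     \<theta> / (2 * (real n - 1)) * (2 * K * k - K\<^sup>2 + (max 0 (k - K))\<^sup>2) - \<theta> / 2 + \<beta> i / 2 * k)"

lemma linearised_eq_two_star:
  "(real n - 1) * s \<le> k \<Longrightarrow> linearised_two_star n \<theta> \<beta> s i k = two_star n \<theta> \<beta> i k"
  unfolding linearised_two_star_def two_star_def Let_def
  by (subst max_absorb2) (simp_all add: power2_eq_square algebra_simps)

text \<open>(k + 2)^2 - k^2 = 4 (k + 1), so the increment is 2 \<theta> (k + 1) / (n - 1) +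
  \<open>\<beta> i\<close>, and a nonnegative field only raises it.\<close>

lemma incr_two_star:
  assumes "n \<ge> 2" "\<theta> > 0" "\<beta> i \<ge> 0" "(real n - 1) * r \<le> k"
  shows "2 * (\<theta> * r) \<le> incr (two_star n \<theta> \<beta> i) k"
proof -
  define m where "m = real n - 1"
  have m: "m > 0" using assms(1) by (simp add: m_def)
  have "incr (two_star n \<theta> \<beta> i) k = \<theta> / (2 * m) * (4 * (k + 1)) + \<beta> i"
    unfolding incr_def two_star_def m_def[symmetric]
    by (simp add: power2_eq_square ring_distribs add_divide_distrib)
  moreover have "\<theta> / (2 * m) * (4 * (m * r)) \<le> \<theta> / (2 * m) * (4 * (k + 1))"
    using assms m by (intro mult_left_mono) (auto simp: m_def[symmetric])
  moreover have "\<theta> / (2 * m) * (4 * (m * r)) = 2 * (\<theta> * r)" using m by simp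
  ultimately show ?thesis using assms(3) by linarith
qed

lemma incr_linearised:
  assumes "n \<ge> 2"
  shows "incr (linearised_two_star n \<theta> \<beta> s i) k = 2 * (\<theta> * s) + \<beta> i
    + \<theta> / (2 * (real n - 1)) * incr (\<lambda>x. (max 0 (x - (real n - 1) * s))\<^sup>2) k"
proof -
  define m where "m = real n - 1"
  have m: "m > 0" using assms(1) by (simp add: m_def)
  define K where "K = m * s"
  have "incr (linearised_two_star n \<theta> \<beta> s i) k
    = \<theta> / (2 * m) * (4 * K) + \<beta> i + \<theta> / (2 * m) * incr (\<lambda>x. (max 0 (x - K))\<^sup>2) k"
    unfolding incr_def linearised_two_star_def m_def[symmetric] K_def[symmetric] Let_def
    by (simp add: ring_distribs diff_divide_distrib add_divide_distrib)
  also have "\<theta> / (2 * m) * (4 * K) = 2 * (\<theta> * s)" using m by (simp add: K_def)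
  finally show ?thesis by (simp add: m_def K_def)
qed

text \<open>The tangent contributes exactly \<open>2 * (\<theta> * s)\<close> and the squared
  positive part is nondecreasing. The bound thus holds at every degree, which lets the tail estimate
  start from all of \<open>Pow (edges n)\<close>.\<close>

lemma incr_linearised_lower:
  assumes "n \<ge> 2" "\<theta> > 0" "\<beta> i \<ge> 0"
  shows "2 * (\<theta> * s) \<le> incr (linearised_two_star n \<theta> \<beta> s i) k"
proof -
  have "0 \<le> incr (\<lambda>x. (max 0 (x - (real n - 1) * s))\<^sup>2) k"
    by (auto simp: incr_def intro!: power_mono)
  then have "0 \<le> \<theta> / (2 * (real n - 1)) * incr (\<lambda>x. (max 0 (x - (real n - 1) * s))\<^sup>2) k"
    using assms by (intro mult_nonneg_nonneg) auto
  then show ?thesis using assms(3) unfolding incr_linearised[OF assms(1)] by linarith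
qed

text \<open>The squared positive part is at most as curved as the square, whose second difference at
  step 2 is 8. The cases locate the kink among \<open>k\<close>, \<open>k + 2\<close> and
  \<open>k + 4\<close>.\<close>

lemma second_difference_pos_part_sq:
  "\<bar>incr (\<lambda>x. (max 0 (x - K))\<^sup>2) (k + 2) - incr (\<lambda>x. (max 0 (x - K))\<^sup>2) k\<bar> \<le> (8::real)"
proof -
  define z where "z = k - K"
  have eq: "incr (\<lambda>x. (max 0 (x - K))\<^sup>2) (k + 2) - incr (\<lambda>x. (max 0 (x - K))\<^sup>2) k
    = (max 0 (z + 4))\<^sup>2 - 2 * (max 0 (z + 2))\<^sup>2 + (max 0 z)\<^sup>2"
    by (simp add: incr_def z_def algebra_simps)
  consider "z \<ge> 0" | "z < 0" "z \<ge> -2" | "z < -2" "z \<ge> -4" | "z < -4" by linarith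
  then show ?thesis
  proof cases
    case 1
    then show ?thesis unfolding eq by (simp add: power2_eq_square algebra_simps)
  next
    case 2
    have eq': "(max 0 (z + 4))\<^sup>2 - 2 * (max 0 (z + 2))\<^sup>2 + (max 0 z)\<^sup>2 = 8 - z\<^sup>2"
      using 2 by (simp add: power2_eq_square algebra_simps)
    have "z\<^sup>2 \<le> 2\<^sup>2" using 2 by (intro abs_le_square_iff[THEN iffD1]) auto
    then show ?thesis unfolding eq eq' using zero_le_power2[of z] by (simp add: abs_le_iff)
  next
    case 3
    have "(z + 4)\<^sup>2 \<le> 2\<^sup>2" using 3 by (intro power_mono) auto
    then show ?thesis unfolding eq using 3 by simp
  next
    case 4
    then show ?thesis unfolding eq by simp
  qed
qed

lemma incr_linearised_lipschitz:
  assumes "n \<ge> 2" "\<theta> > 0"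
  shows "\<bar>incr (linearised_two_star n \<theta> \<beta> s i) (k + 2) - incr (linearised_two_star n \<theta> \<beta> s i) k\<bar>
    \<le> 4 * \<theta> / (real n - 1)"
proof -
  let ?p = "\<lambda>x. (max 0 (x - (real n - 1) * s))\<^sup>2"
  have eq: "incr (linearised_two_star n \<theta> \<beta> s i) (k + 2) - incr (linearised_two_star n \<theta> \<beta> s i) k
    = \<theta> / (2 * (real n - 1)) * (incr ?p (k + 2) - incr ?p k)"
    unfolding incr_linearised[OF assms(1)] by (simp add: right_diff_distrib)
  have "\<theta> / (2 * (real n - 1)) * \<bar>incr ?p (k + 2) - incr ?p k\<bar> \<le> \<theta> / (2 * (real n - 1)) * 8"
    by (rule mult_left_mono[OF second_difference_pos_part_sq]) (use assms in simp)
  also have "\<theta> / (2 * (real n - 1)) * 8 = 4 * \<theta> / (real n - 1)"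
    using assms by (simp add: field_simps)
  finally show ?thesis unfolding eq abs_mult using assms by simp
qed

section \<open>From the conditioned model to weights on edge sets\<close>

lemma weight_to_config:
  assumes "n \<ge> 2"
  shows "weight n \<theta> \<beta> (to_config n S) = gibbs_weight n (two_star n \<theta> \<beta>) S"
proof -
  define m where "m = real n - 1"
  have m: "m > 0" using assms by (simp add: m_def)
  define d where "d i = edge_deg n i S" for i
  have deg: "deg n i (to_config n S) = d i" if "i \<in> {1..n}" for i
    unfolding d_def by (rule deg_to_config[OF that])
  have "(\<Sum>i=1..n. two_star n \<theta> \<beta> i (d i)) =
      \<theta> / (2 * m) * (\<Sum>i=1..n. (d i)\<^sup>2) - real n * (\<theta> / 2) + (\<Sum>i=1..n. \<beta> i / 2 * d i)"
    by (simp add: two_star_def m_def sum.distrib sum_subtractf sum_distrib_left)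
  also have "(\<Sum>i=1..n. \<beta> i / 2 * d i) = 1 / 2 * (\<Sum>i=1..n. \<beta> i * d i)"
    by (simp add: sum_distrib_left)
  also have "\<theta> / (2 * m) * (\<Sum>i=1..n. (d i)\<^sup>2) - real n * (\<theta> / 2)
      = \<theta> / m * (1 / 2 * (\<Sum>i=1..n. (d i)\<^sup>2) - real n * m / 2)"
    using m by (simp add: field_simps)
  finally show ?thesis
    unfolding weight_def gibbs_weight_def m_def d_def[symmetric] by (simp add: deg)
qed

lemma to_config_in_U:
  assumes "S \<subseteq> edges n"
  shows "to_config n S \<in> U_event n \<theta> \<longleftrightarrow> S \<in> above n (pos_root \<theta> / 2)"
proof -
  have "to_config n S \<in> U_event n \<theta> \<longleftrightarrow>
      (\<forall>i\<in>{1..n}. (real n - 1) * pos_root \<theta> / 2 \<le> deg n i (to_config n S))"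
    by (simp add: U_event_def)
  also have "\<dots> \<longleftrightarrow> (\<forall>i\<in>{1..n}. (real n - 1) * (pos_root \<theta> / 2) \<le> edge_deg n i S)"
    by (intro ball_cong refl) (simp add: deg_to_config)
  also have "\<dots> \<longleftrightarrow> S \<in> above n (pos_root \<theta> / 2)"
    using assms by (simp add: above_def)
  finally show ?thesis .
qed

lemma configs_Int_U:
  "configs n \<inter> U_event n \<theta> = to_config n ` above n (pos_root \<theta> / 2)"
proof -
  have "configs n = to_config n ` Pow (edges n)"
    using bij_to_config by (simp add: bij_betw_def)
  then have "configs n \<inter> U_event n \<theta> = to_config n ` {S \<in> Pow (edges n). to_config n S \<in> U_event n \<theta>}"
    by auto
  also have "{S \<in> Pow (edges n). to_config n S \<in> U_event n \<theta>} = above n (pos_root \<theta> / 2)"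
    using to_config_in_U[of _ n \<theta>] above_subset[of n "pos_root \<theta> / 2"] by auto
  finally show ?thesis .
qed

text \<open>Conditioning restricts to a finite sum over the matrices in U, and \<open>Zn\<close>
  cancels.\<close>

lemma expectation_cond_ergm:
  assumes "\<theta> > 1/2"
  shows "(\<integral>Y. f Y \<partial>measure_pmf (cond_pmf (ergm n \<theta> \<beta>) (U_event n \<theta>)))
    = wmean (configs n \<inter> U_event n \<theta>) (weight n \<theta> \<beta>) f"
proof -
  let ?p = "ergm n \<theta> \<beta>" and ?U = "U_event n \<theta>"
  define A where "A = configs n \<inter> ?U"
  have A: "finite A" by (simp add: A_def finite_configs)
  have ne: "set_pmf ?p \<inter> ?U \<noteq> {}" by (rule U_event_possible[OF assms])
  have "measure ?p ?U = measure ?p A"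
    using measure_Int_set_pmf[of ?p ?U] by (simp add: A_def set_pmf_ergm Int_commute)
  also have "\<dots> = (\<Sum>Y\<in>A. weight n \<theta> \<beta> Y / Zn n \<theta> \<beta>)"
    using A by (subst measure_measure_pmf_finite) (auto simp: pmf_ergm A_def)
  finally have U: "measure ?p ?U = sum (weight n \<theta> \<beta>) A / Zn n \<theta> \<beta>"
    by (simp add: sum_divide_distrib)
  have "(\<integral>Y. f Y \<partial>measure_pmf (cond_pmf ?p ?U)) = (\<Sum>Y\<in>A. f Y * pmf (cond_pmf ?p ?U) Y)"
    by (rule integral_measure_pmf_real[OF A]) (auto simp: A_def set_cond_pmf[OF ne] set_pmf_ergm)
  also have "\<dots> = (\<Sum>Y\<in>A. weight n \<theta> \<beta> Y * f Y / sum (weight n \<theta> \<beta>) A)"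
    using Zn_pos[of n \<theta> \<beta>]
    by (intro sum.cong) (auto simp: A_def pmf_cond[OF ne] U[unfolded A_def] pmf_ergm)
  finally show ?thesis by (simp add: wmean_def A_def sum_divide_distrib)
qed

lemma wmean_image:
  assumes "inj_on h A" shows "wmean (h ` A) w f = wmean A (w \<circ> h) (f \<circ> h)"
  unfolding wmean_def using assms by (simp add: sum.reindex o_def)

lemma wmean_cong:
  assumes "\<And>x. x \<in> A \<Longrightarrow> w x = w' x" "\<And>x. x \<in> A \<Longrightarrow> f x = f' x"
  shows "wmean A w f = wmean A w' f'"
  unfolding wmean_def using assms by (intro arg_cong2[where f = "(/)"] sum.cong) auto

lemma cov_deg_U_eq_wcov:
  assumes "\<theta> > 1/2" "n \<ge> 2" and ij: "i \<in> {1..n}" "j \<in> {1..n}"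
  shows "cov_deg_U n \<theta> \<beta> i j = wcov (above n (pos_root \<theta> / 2))
    (gibbs_weight n (two_star n \<theta> \<beta>)) (edge_deg n i) (edge_deg n j)"
proof -
  let ?A = "above n (pos_root \<theta> / 2)" and ?w = "gibbs_weight n (two_star n \<theta> \<beta>)"
  have inj: "inj_on (to_config n) ?A"
    by (rule inj_on_subset[OF bij_betw_imp_inj_on[OF bij_to_config] above_subset])
  have E: "(\<integral>Y. f Y \<partial>measure_pmf (cond_pmf (ergm n \<theta> \<beta>) (U_event n \<theta>)))
      = wmean ?A ?w (f \<circ> to_config n)" for f
    unfolding expectation_cond_ergm[OF assms(1)] configs_Int_U wmean_image[OF inj]
    by (intro wmean_cong) (simp_all add: weight_to_config[OF assms(2)])
  have d: "deg n k \<circ> to_config n = edge_deg n k" if "k \<in> {1..n}" for k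
    using deg_to_config[OF that] by (simp add: fun_eq_iff)
  show ?thesis
    unfolding cov_deg_U_def covariance_def E wcov_def d[OF ij(1)] d[OF ij(2)]
    by (intro wmean_cong) (simp_all add: deg_to_config[OF ij(1)] deg_to_config[OF ij(2)])
qed

text \<open>The cube collects the square of the degree bound and the factor n of the union
  bound.\<close>

lemma poly_times_exp_small:
  fixes M \<rho> \<epsilon> :: real
  assumes "0 < \<rho>" "\<rho> < 1" "0 < \<epsilon>"
  shows "(\<lambda>n. M * real n ^ 3 * \<rho> ^ nat \<lfloor>(real n - 1) * \<epsilon> / 4\<rfloor>) \<longlonglongrightarrow> 0"
proof -
  define a where "a = - ln \<rho> * \<epsilon> / 4"
  define B where "B = exp (a - ln \<rho>)"
  have a: "a > 0" using assms by (simp add: a_def mult_neg_pos)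
  have bound: "\<rho> ^ nat \<lfloor>(real n - 1) * \<epsilon> / 4\<rfloor> \<le> B * exp (- a * real n)" for n
  proof -
    let ?x = "(real n - 1) * \<epsilon> / 4"
    \<comment> \<open>The floor loses at most 1, which \<open>B\<close> absorbs.\<close>
    have "?x - 1 \<le> real (nat \<lfloor>?x\<rfloor>)" by linarith
    then have "real (nat \<lfloor>?x\<rfloor>) * ln \<rho> \<le> (?x - 1) * ln \<rho>"
      using assms by (intro mult_right_mono_neg) auto
    also have "\<dots> = (a - ln \<rho>) + (- a * real n)" by (simp add: a_def field_simps)
    finally have "exp (real (nat \<lfloor>?x\<rfloor>) * ln \<rho>) \<le> B * exp (- a * real n)"
      unfolding B_def exp_add[symmetric] by simp
    then show ?thesis using assms by (simp add: exp_of_nat_mult)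
  qed
  have "(\<lambda>n. \<bar>M\<bar> * B * (real n ^ 3 * exp (- a * real n))) \<longlonglongrightarrow> \<bar>M\<bar> * B * 0"
  proof (intro tendsto_intros)
    show "(\<lambda>n. real n ^ 3 * exp (- a * real n)) \<longlonglongrightarrow> 0" using a by real_asymp
  qed
  then have lim: "(\<lambda>n. \<bar>M\<bar> * B * (real n ^ 3 * exp (- a * real n))) \<longlonglongrightarrow> 0" by simp
  show ?thesis
  proof (rule Lim_null_comparison[OF _ lim])
    show "\<forall>\<^sub>F n in sequentially. norm (M * real n ^ 3 * \<rho> ^ nat \<lfloor>(real n - 1) * \<epsilon> / 4\<rfloor>)
      \<le> \<bar>M\<bar> * B * (real n ^ 3 * exp (- a * real n))"
    proof (intro always_eventually allI)
      fix n
      have "\<bar>M\<bar> * real n ^ 3 * \<rho> ^ nat \<lfloor>(real n - 1) * \<epsilon> / 4\<rfloor>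
          \<le> \<bar>M\<bar> * real n ^ 3 * (B * exp (- a * real n))"
        by (intro mult_left_mono bound) auto
      then show "norm (M * real n ^ 3 * \<rho> ^ nat \<lfloor>(real n - 1) * \<epsilon> / 4\<rfloor>)
          \<le> \<bar>M\<bar> * B * (real n ^ 3 * exp (- a * real n))"
        using assms by (simp add: abs_mult mult_ac)
    qed
  qed
qed

text \<open>For large \<open>n\<close> the comparison through \<open>above n s\<close> applies, with
  error 20 n^2 \<delta> below 10; each \<open>n\<close> below the threshold \<open>N\<close> is
  covered by the crude bound 4 N^2.\<close>

lemma cov_deg_U_bounded:
  fixes \<theta> :: real
  assumes "\<theta> > 1/2"
  shows "\<exists>C. \<forall>n i j \<beta>. n \<ge> 2 \<longrightarrow> i \<in> {1..n} \<longrightarrow> j \<in> {1..n} \<longrightarrow> i \<noteq> j \<longrightarrow> (\<forall>k\<in>{1..n}. \<beta> k \<ge> 0)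
    \<longrightarrow> cov_deg_U n \<theta> \<beta> i j \<le> C"
proof -
  have \<theta>: "\<theta> > 0" using assms by simp
  define t where "t = pos_root \<theta>"
  have t: "t > 0" using pos_root[OF assms] by (simp add: t_def)
  obtain s \<epsilon> where s: "t / 2 \<le> s" and \<epsilon>: "0 < \<epsilon>" "\<epsilon> \<le> 1"
    and c_less: "2 * (\<theta> * (1 - (tanh (2 * (\<theta> * s)))\<^sup>2)) < 1"
    and gap: "\<And>r. t / 2 \<le> r \<Longrightarrow> r \<le> s \<Longrightarrow> r + 2 * \<epsilon> \<le> tanh (2 * \<theta> * r)"
    using tanh_gap[OF assms t_def] by metis
  define c where "c = \<theta> * (1 - (tanh (2 * (\<theta> * s)))\<^sup>2)"
  have c: "0 \<le> c" "2 * c < 1"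
    using c_less \<theta> tanh_sq_less_1[of "2 * (\<theta> * s)"] by (auto simp: c_def)
  define C where "C = (2 + 4 * c) / (1 - 2 * c)\<^sup>2"
  have C: "C \<ge> 0" using c by (simp add: C_def)
  \<comment> \<open>Enough rounds of size \<open>\<epsilon>\<close> to climb from
    \<open>t / 2\<close> to \<open>s\<close>. \<open>Suc\<close> ensures \<open>q \<ge> 1\<close>,
    so that \<open>\<delta>\<close> also dominates the single-round error of the linearised
    weight.\<close>
  define q where "q = Suc (nat \<lceil>(s - t / 2) / \<epsilon>\<rceil>)"
  have "(s - t / 2) / \<epsilon> \<le> real q" unfolding q_def by linarith
  then have q: "min s (t / 2 + real q * \<epsilon>) = s" "real q \<ge> 1"
    using \<epsilon> by (auto simp: field_simps q_def)
  define \<rho> where "\<rho> = 1 - \<epsilon> / 2"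
  have \<rho>: "0 < \<rho>" "\<rho> < 1" using \<epsilon> by (auto simp: \<rho>_def)
  define \<delta> where "\<delta> n = real q * (real n * \<rho> ^ nat \<lfloor>(real n - 1) * \<epsilon> / 4\<rfloor>)" for n
  have \<delta>0: "\<delta> n \<ge> 0" for n using \<rho> by (simp add: \<delta>_def)
  have "\<forall>\<^sub>F n in sequentially. (real n)\<^sup>2 * \<delta> n < 1/2"
    using order_tendstoD(2)[OF poly_times_exp_small[OF \<rho> \<epsilon>(1), of "real q"], of "1/2"]
    by (simp add: \<delta>_def power2_eq_square power3_eq_cube mult_ac)
  then obtain N where N: "\<And>n. n \<ge> N \<Longrightarrow> (real n)\<^sup>2 * \<delta> n < 1/2"
    by (auto simp: eventually_sequentially)
  have "cov_deg_U n \<theta> \<beta> i j \<le> max (4 * C + 10) (4 * (real N)\<^sup>2)"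
    if n: "n \<ge> 2" and ij: "i \<in> {1..n}" "j \<in> {1..n}" "i \<noteq> j" and \<beta>: "\<And>k. k \<in> {1..n} \<Longrightarrow> \<beta> k \<ge> 0" for n i j \<beta>
  proof -
    let ?A = "above n (t / 2)" and ?B = "Pow (edges n)" and ?V = "above n s"
    let ?w = "gibbs_weight n (two_star n \<theta> \<beta>)"
    let ?w' = "gibbs_weight n (linearised_two_star n \<theta> \<beta> s)"
    have eq: "cov_deg_U n \<theta> \<beta> i j = wcov ?A ?w (edge_deg n i) (edge_deg n j)"
      unfolding t_def by (rule cov_deg_U_eq_wcov[OF assms n ij(1,2)])
    \<comment> \<open>The complete graph witnesses that the conditioned weight has positive
      mass.\<close>
    have "edges n \<in> ?A"
    proof -
      have "edge_deg n k (edges n) = real n - 1" if "k \<in> {1..n}" for k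
        unfolding edge_deg_card using card_incident[OF that] that
        by (simp add: Int_absorb2 incident_subset of_nat_diff)
      moreover have "(real n - 1) * (t / 2) \<le> (real n - 1) * 1"
        using n pos_root[OF assms] by (intro mult_left_mono) (auto simp: t_def)
      ultimately show ?thesis by (simp add: above_def)
    qed
    then have pos: "sum ?w ?A > 0" by (intro sum_pos) auto
    have pos': "sum ?w' ?B > 0" by (intro sum_pos) auto
    show ?thesis
    proof (cases "n < N")
      case True
      have "cov_deg_U n \<theta> \<beta> i j \<le> 4 * (real n)\<^sup>2"
        unfolding eq using pos ij by (intro wcov_le_sup) (auto simp: less_imp_le intro: abs_edge_deg_le)
      also have "\<dots> \<le> 4 * (real N)\<^sup>2" using True by (intro mult_left_mono power_mono) auto
      finally show ?thesis by simp
    next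
      case False
      then have small: "(real n)\<^sup>2 * \<delta> n < 1/2" using N by simp
      have "1 * \<delta> n \<le> (real n)\<^sup>2 * \<delta> n" using n \<delta>0[of n] by (intro mult_right_mono) auto
      then have \<delta>_half: "\<delta> n \<le> 1/2" using small by simp
      have "wcov ?A ?w (edge_deg n i) (edge_deg n j) \<le> 4 * C + 20 * (real n)\<^sup>2 * \<delta> n"
      proof (rule wcov_compare[where V = ?V and B = ?B and w' = ?w'])
        show "?V \<subseteq> ?A" using above_mono s n by auto
        show "?w S = ?w' S" if "S \<in> ?V" for S
          using that unfolding gibbs_weight_def
          by (intro arg_cong[where f = exp] sum.cong) (auto simp: above_def linearised_eq_two_star)
        have "sum ?w (?A - above n (min s (t / 2 + real q * \<epsilon>)))
            \<le> real q * (real n * (1 - \<epsilon> / 2) ^ nat \<lfloor>(real n - 1) * \<epsilon> / 4\<rfloor>) * sum ?w ?A"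
        proof (rule min_degree_bootstrap[where \<theta> = \<theta>])
          show "2 * (\<theta> * r) \<le> incr (two_star n \<theta> \<beta> k) x"
            if "k \<in> {1..n}" "(real n - 1) * r \<le> x" for k r x
            using n \<theta> \<beta>[OF that(1)] that(2) by (rule incr_two_star)
        qed (use n t s \<epsilon> gap in auto)
        then show "sum ?w (?A - ?V) \<le> \<delta> n * sum ?w ?A"
          by (simp add: q(1) \<delta>_def \<rho>_def)
        \<comment> \<open>The linearised weight grows at the rate of level \<open>s\<close>
          everywhere, so one round from all edge sets suffices.\<close>
        have "sum ?w' (?B - ?V)
            \<le> real n * (1 - \<epsilon> / 2) ^ nat \<lfloor>(real n - 1) * \<epsilon> / 4\<rfloor> * sum ?w' ?B"
        proof (rule min_degree_tail[where l = "\<theta> * s"])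
          show "s + \<epsilon> \<le> tanh (2 * (\<theta> * s))" using gap[of s] s \<epsilon> by (simp add: mult.assoc)
          show "2 * (\<theta> * s) \<le> incr (linearised_two_star n \<theta> \<beta> s k) (edge_deg n k S)"
            if "k \<in> {1..n}" for k S
            using that by (intro incr_linearised_lower n \<theta> \<beta>)
        qed (use s t \<epsilon> in auto)
        also have "\<dots> = 1 * (real n * \<rho> ^ nat \<lfloor>(real n - 1) * \<epsilon> / 4\<rfloor>) * sum ?w' ?B"
          by (simp add: \<rho>_def)
        also have "\<dots> \<le> \<delta> n * sum ?w' ?B"
          unfolding \<delta>_def using q(2) \<rho> pos' by (intro mult_right_mono) auto
        finally show "sum ?w' (?B - ?V) \<le> \<delta> n * sum ?w' ?B" .
        show "wcov ?B ?w' (edge_deg n i) (edge_deg n j) \<le> C"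
          unfolding C_def
        proof (rule gibbs_wcov_le[OF ij n _ \<theta> _ _ c_def c(2)])
          show "0 \<le> \<theta> * s" using \<theta> s t by simp
          show "2 * (\<theta> * s) \<le> incr (linearised_two_star n \<theta> \<beta> s k) x" if "k \<in> {1..n}" for k x
            using that by (intro incr_linearised_lower n \<theta> \<beta>)
        qed (rule incr_linearised_lipschitz[OF n \<theta>])
      qed (use above_subset pos pos' ij C \<delta>_half in \<open>auto simp: less_imp_le intro: abs_edge_deg_le\<close>)
      then have "cov_deg_U n \<theta> \<beta> i j \<le> 4 * C + 10" unfolding eq using small by linarith
      then show ?thesis by simp
    qed
  qed
  then show ?thesis by blast
qed

text \<open>Suprema are taken in the extended reals, where they always exist, so the inequality
  itself asserts boundedness.\<close>

theorem lemma3p3: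
  fixes \<theta> :: real
  assumes "\<theta> > 1/2"
  shows "\<exists>C::real. \<forall>n::nat. n \<ge> 2 \<longrightarrow>
    (MAX (i, j) \<in> {(i, j). 1 \<le> i \<and> i < j \<and> j \<le> n}.
       SUP \<beta> \<in> {1..n} \<rightarrow>\<^sub>E {0..2 * real n powr (-1/2)}. ereal (cov_deg_U n \<theta> \<beta> i j)) \<le> ereal C"
proof -
  obtain C where C: "\<And>n i j \<beta>. n \<ge> 2 \<Longrightarrow> i \<in> {1..n} \<Longrightarrow> j \<in> {1..n} \<Longrightarrow> i \<noteq> j \<Longrightarrow>
      \<forall>k\<in>{1..n}. \<beta> k \<ge> 0 \<Longrightarrow> cov_deg_U n \<theta> \<beta> i j \<le> C"
    using cov_deg_U_bounded[OF assms] by metis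
  show ?thesis
  proof (intro exI allI impI)
    fix n :: nat assume n: "n \<ge> 2"
    let ?I = "{(i, j). 1 \<le> i \<and> i < j \<and> j \<le> n}"
    \<comment> \<open>The maximum needs a finite nonempty index set; \<open>n \<ge> 2\<close>
      supplies the pair (1, 2).\<close>
    have "finite ?I" by (rule finite_subset[of _ "{..n} \<times> {..n}"]) auto
    moreover have "(1, 2) \<in> ?I" using n by auto
    then have "?I \<noteq> {}" by blast
    ultimately show "(MAX (i, j) \<in> ?I. SUP \<beta> \<in> {1..n} \<rightarrow>\<^sub>E {0..2 * real n powr (-1/2)}.
        ereal (cov_deg_U n \<theta> \<beta> i j)) \<le> ereal C"
      using n by (subst Max_le_iff) (auto intro!: SUP_least C simp: PiE_iff)
  qed
qed

end
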